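(* Let $\Delta$ be a prime field, let $\overline{\Delta}$ be its algebraic closure and let $P$ be a Galois extension of $\Delta$ in $\overline{\Delta}$. Denote by $\Sigma$ the set of all Galois extensions of $\Delta$ in $P$. Then between the set $\Sigma_L$ of all Paige loops $M(F)$, where $F\in\Sigma$, and the set $\Sigma_G$ of all normal subgroups $H=G(P/F)$ (with $F$ a field, $\Delta\subseteq F\subseteq P$) of the automorphism group $G=\mathrm{Aut}\,P$ there exists a one-to-one mapping defined by $F=P^H$. Concretely: 1) each Paige loop $M(F)$, $F\in\Sigma$, has a corresponding normal subgroup $H=G(P/F)\in\Sigma_G$, induced by the isomorphism $\mathrm{Aut}\,F\cong \mathrm{Aut}\,P/G(P/F)$; 2) the field $F$ is determined in a unique manner by $F=P^H$; 3) for each normal subgroup $H\in\Sigma_G$ there is a field $F\in\Sigma$ such that $H=G(P/F)$ and $F=P^H$; 4) let $M(F),H$ and $M(F'),H'$ be pairs with $F,F'\in\Sigma$, $H=G(P/F)$ and $H'=G(P/F')$. Then $M(F)\subset M(F')$ (resp. $M(F)\neq M(F')$, or $M(F)\supset M(F')$) if and only if $H\supset H'$ (resp. $H\neq H'$, or $H\subset H'$).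
   Context: A prime field is the field of rational numbers or $GF(p)$ with $p$ prime. A Galois extension is an algebraic, separable and normal field extension (not necessarily finite). For a normal extension $K$ of $E$, $G(K/E)$ is the group of all field automorphisms of $K$ fixing every element of $E$. For a subgroup $H$ of $\mathrm{Aut}\,K$, $K^H=\{x\in K\mid \varphi x=x\ \forall\varphi\in H\}$ is its fixed field. For a field $F$, the matrix Cayley-Dickson algebra $C(F)$ consists of the matrices $\left(\begin{array}{ll}\alpha_1&\alpha_{12}\\ \alpha_{21}&\alpha_2\end{array}\right)$ with $\alpha_1,\alpha_2\in F$, $\alpha_{12},\alpha_{21}\in F^3$, with the usual entrywise addition and scalar multiplication, and with product $$\left(\begin{array}{ll}\alpha_1&\alpha_{12}\\ \alpha_{21}&\alpha_2\end{array}\right)\left(\begin{array}{ll}\beta_1&\beta_{12}\\ \beta_{21}&\beta_2\end{array}\right)=\left(\begin{array}{ll}\alpha_1\beta_1+(\alpha_{12},\beta_{21})&\alpha_1\beta_{12}+\beta_2\alpha_{12}-\alpha_{21}\times\beta_{21}\\ \beta_1\alpha_{21}+\alpha_2\beta_{21}+\alpha_{12}\times\beta_{12}&\alpha_2\beta_2+(\alpha_{21},\beta_{12})\end{array}\right),$$ where $(\cdot,\cdot)$ is the standard scalar product and $\times$ the vector product on $F^3$. The norm is $n(a)=\alpha_1\alpha_2-(\alpha_{12},\alpha_{21})$. $M^{\star}(F)$ is the Moufang loop of all elements of $C(F)$ of norm $1$, and $M(F)=M^{\star}(F)/\{\pm1\}$ is the Paige loop over $F$. For subfields $F\subseteq F'$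 of $\overline{\Delta}$, $M(F)$ is regarded as a subloop of $M(F')$. *)

theory Defs
  imports
    "HOL-Algebra.Algebra"
    "HOL-Algebra.Algebraic_Closure"
    "HOL-Algebra.Algebraic_Closure_Type"
    "HOL-Number_Theory.Residues"
begin

section \<open>Prime fields, Galois extensions and automorphism groups\<close>

definition prime_field :: "('a, 'b) ring_scheme \<Rightarrow> bool" where
  "prime_field R \<longleftrightarrow>
     field R \<and>
     (R \<simeq> (ring_of_type_algebra :: rat ring) \<or> (\<exists>p::nat. Factorial_Ring.prime p \<and> R \<simeq> residue_ring (int p)))"

text \<open>Subfields of an ambient field \<open>A\<close> are represented by their carrier sets, as in
  \<^locale>\<open>subfield\<close>; the subfield with carrier \<open>F\<close>, as a field in its own right, is
  \<open>A\<lparr>carrier := F\<rparr>\<close>.\<close>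

definition field_extension :: "('a, 'b) ring_scheme \<Rightarrow> 'a set \<Rightarrow> 'a set \<Rightarrow> bool" where
  "field_extension A K E \<longleftrightarrow> subfield K A \<and> subfield E A \<and> K \<subseteq> E"

definition algebraic_extension :: "('a, 'b) ring_scheme \<Rightarrow> 'a set \<Rightarrow> 'a set \<Rightarrow> bool" where
  "algebraic_extension A K E \<longleftrightarrow> field_extension A K E \<and> (\<forall>x\<in>E. (ring.algebraic A over K) x)"

text \<open>The multiplicities are those of roots in the ambient field \<open>A\<close>, so the following
  is the usual notion of separability only if \<open>A\<close> is algebraically closed.\<close>

definition separable_extension :: "('a, 'b) ring_scheme \<Rightarrow> 'a set \<Rightarrow> 'a set \<Rightarrow> bool" where
  "separable_extension A K E \<longleftrightarrow>
     algebraic_extension A K E \<and>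
     (\<forall>x\<in>E. \<forall>a\<in>carrier A. ring.alg_mult A (ring.Irr A K x) a \<le> 1)"

definition normal_extension :: "('a, 'b) ring_scheme \<Rightarrow> 'a set \<Rightarrow> 'a set \<Rightarrow> bool" where
  "normal_extension A K E \<longleftrightarrow>
     algebraic_extension A K E \<and>
     (\<forall>p\<in>carrier (K[X]\<^bsub>A\<^esub>).
        pirreducible\<^bsub>A\<^esub> K p \<longrightarrow> (\<exists>x\<in>E. ring.eval A p x = \<zero>\<^bsub>A\<^esub>) \<longrightarrow>
        ring.splitted (A\<lparr>carrier := E\<rparr>) p)"

definition galois_extension :: "('a, 'b) ring_scheme \<Rightarrow> 'a set \<Rightarrow> 'a set \<Rightarrow> bool" where
  "galois_extension A K E \<longleftrightarrow>
     algebraic_extension A K E \<and> separable_extension A K E \<and> normal_extension A K E"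

text \<open>As in \<^const>\<open>AutoGroup\<close>, automorphisms are extensional functions on the carrier.\<close>

definition ring_aut_group :: "('a, 'b) ring_scheme \<Rightarrow> ('a \<Rightarrow> 'a) monoid" where
  "ring_aut_group R =
     BijGroup (carrier R)\<lparr>carrier := ring_hom R R \<inter> Bij (carrier R)\<rparr>"

abbreviation field_Aut :: "('a, 'b) ring_scheme \<Rightarrow> 'a set \<Rightarrow> ('a \<Rightarrow> 'a) monoid" where
  "field_Aut A K \<equiv> ring_aut_group (A\<lparr>carrier := K\<rparr>)"

definition galois_group :: "('a, 'b) ring_scheme \<Rightarrow> 'a set \<Rightarrow> 'a set \<Rightarrow> ('a \<Rightarrow> 'a) set" where
  "galois_group A K E = {\<phi> \<in> carrier (field_Aut A K). \<forall>x\<in>E. \<phi> x = x}"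

definition fixed_field :: "'a set \<Rightarrow> ('a \<Rightarrow> 'a) set \<Rightarrow> 'a set" where
  "fixed_field K H = {x \<in> K. \<forall>\<phi>\<in>H. \<phi> x = x}"


section \<open>The matrix Cayley-Dickson algebra and Paige loops\<close>

type_synonym 'a vec3 = "'a \<times> 'a \<times> 'a"

definition scalar_prod3 :: "('a, 'b) ring_scheme \<Rightarrow> 'a vec3 \<Rightarrow> 'a vec3 \<Rightarrow> 'a" where
  "scalar_prod3 R = (\<lambda>(u1, u2, u3) (v1, v2, v3).
     u1 \<otimes>\<^bsub>R\<^esub> v1 \<oplus>\<^bsub>R\<^esub> u2 \<otimes>\<^bsub>R\<^esub> v2 \<oplus>\<^bsub>R\<^esub> u3 \<otimes>\<^bsub>R\<^esub> v3)"

definition vector_prod3 :: "('a, 'b) ring_scheme \<Rightarrow> 'a vec3 \<Rightarrow> 'a vec3 \<Rightarrow> 'a vec3" where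
  "vector_prod3 R = (\<lambda>(u1, u2, u3) (v1, v2, v3).
     (u2 \<otimes>\<^bsub>R\<^esub> v3 \<ominus>\<^bsub>R\<^esub> u3 \<otimes>\<^bsub>R\<^esub> v2,
      u3 \<otimes>\<^bsub>R\<^esub> v1 \<ominus>\<^bsub>R\<^esub> u1 \<otimes>\<^bsub>R\<^esub> v3,
      u1 \<otimes>\<^bsub>R\<^esub> v2 \<ominus>\<^bsub>R\<^esub> u2 \<otimes>\<^bsub>R\<^esub> v1))"

definition add3 :: "('a, 'b) ring_scheme \<Rightarrow> 'a vec3 \<Rightarrow> 'a vec3 \<Rightarrow> 'a vec3" where
  "add3 R = (\<lambda>(u1, u2, u3) (v1, v2, v3). (u1 \<oplus>\<^bsub>R\<^esub> v1, u2 \<oplus>\<^bsub>R\<^esub> v2, u3 \<oplus>\<^bsub>R\<^esub> v3))"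

definition diff3 :: "('a, 'b) ring_scheme \<Rightarrow> 'a vec3 \<Rightarrow> 'a vec3 \<Rightarrow> 'a vec3" where
  "diff3 R = (\<lambda>(u1, u2, u3) (v1, v2, v3). (u1 \<ominus>\<^bsub>R\<^esub> v1, u2 \<ominus>\<^bsub>R\<^esub> v2, u3 \<ominus>\<^bsub>R\<^esub> v3))"

definition smult3 :: "('a, 'b) ring_scheme \<Rightarrow> 'a \<Rightarrow> 'a vec3 \<Rightarrow> 'a vec3" where
  "smult3 R c = (\<lambda>(u1, u2, u3). (c \<otimes>\<^bsub>R\<^esub> u1, c \<otimes>\<^bsub>R\<^esub> u2, c \<otimes>\<^bsub>R\<^esub> u3))"

definition zero3 :: "('a, 'b) ring_scheme \<Rightarrow> 'a vec3" where
  "zero3 R = (\<zero>\<^bsub>R\<^esub>, \<zero>\<^bsub>R\<^esub>, \<zero>\<^bsub>R\<^esub>)"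

text \<open>\<open>CD_Mat a1 a12 a21 a2\<close> is the matrix with first row \<open>a1, a12\<close> and second row
  \<open>a21, a2\<close>.\<close>

datatype 'a cd_mat = CD_Mat 'a "'a vec3" "'a vec3" 'a

definition cd_carrier :: "('a, 'b) ring_scheme \<Rightarrow> 'a cd_mat set" where
  "cd_carrier R =
     (let V = carrier R \<times> carrier R \<times> carrier R
      in {CD_Mat a1 a12 a21 a2 | a1 a12 a21 a2.
            a1 \<in> carrier R \<and> a12 \<in> V \<and> a21 \<in> V \<and> a2 \<in> carrier R})"

fun cd_mult :: "('a, 'b) ring_scheme \<Rightarrow> 'a cd_mat \<Rightarrow> 'a cd_mat \<Rightarrow> 'a cd_mat" where
  "cd_mult R (CD_Mat a1 a12 a21 a2) (CD_Mat b1 b12 b21 b2) =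
     CD_Mat
       (a1 \<otimes>\<^bsub>R\<^esub> b1 \<oplus>\<^bsub>R\<^esub> scalar_prod3 R a12 b21)
       (diff3 R (add3 R (smult3 R a1 b12) (smult3 R b2 a12)) (vector_prod3 R a21 b21))
       (add3 R (add3 R (smult3 R b1 a21) (smult3 R a2 b21)) (vector_prod3 R a12 b12))
       (a2 \<otimes>\<^bsub>R\<^esub> b2 \<oplus>\<^bsub>R\<^esub> scalar_prod3 R a21 b12)"

fun cd_add :: "('a, 'b) ring_scheme \<Rightarrow> 'a cd_mat \<Rightarrow> 'a cd_mat \<Rightarrow> 'a cd_mat" where
  "cd_add R (CD_Mat a1 a12 a21 a2) (CD_Mat b1 b12 b21 b2) =
     CD_Mat (a1 \<oplus>\<^bsub>R\<^esub> b1) (add3 R a12 b12) (add3 R a21 b21) (a2 \<oplus>\<^bsub>R\<^esub> b2)"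

fun cd_smult :: "('a, 'b) ring_scheme \<Rightarrow> 'a \<Rightarrow> 'a cd_mat \<Rightarrow> 'a cd_mat" where
  "cd_smult R c (CD_Mat a1 a12 a21 a2) =
     CD_Mat (c \<otimes>\<^bsub>R\<^esub> a1) (smult3 R c a12) (smult3 R c a21) (c \<otimes>\<^bsub>R\<^esub> a2)"

fun cd_norm :: "('a, 'b) ring_scheme \<Rightarrow> 'a cd_mat \<Rightarrow> 'a" where
  "cd_norm R (CD_Mat a1 a12 a21 a2) = a1 \<otimes>\<^bsub>R\<^esub> a2 \<ominus>\<^bsub>R\<^esub> scalar_prod3 R a12 a21"

text \<open>Only the record type is borrowed from the library here: the multiplication is not
  associative.\<close>

definition cayley_dickson :: "('a, 'b) ring_scheme \<Rightarrow> ('a, 'a cd_mat) module" where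
  "cayley_dickson R =
     \<lparr>carrier = cd_carrier R,
      monoid.mult = cd_mult R,
      one = CD_Mat \<one>\<^bsub>R\<^esub> (zero3 R) (zero3 R) \<one>\<^bsub>R\<^esub>,
      ring.zero = CD_Mat \<zero>\<^bsub>R\<^esub> (zero3 R) (zero3 R) \<zero>\<^bsub>R\<^esub>,
      ring.add = cd_add R,
      module.smult = cd_smult R\<rparr>"

definition unit_norm_loop :: "('a, 'b) ring_scheme \<Rightarrow> 'a cd_mat monoid" where
  "unit_norm_loop R =
     \<lparr>carrier = {a \<in> carrier (cayley_dickson R). cd_norm R a = \<one>\<^bsub>R\<^esub>},
      monoid.mult = monoid.mult (cayley_dickson R),
      one = \<one>\<^bsub>cayley_dickson R\<^esub>\<rparr>"

text \<open>\<^const>\<open>FactGroup\<close> presupposes nothing about the structure it is applied to: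
  its carrier consists of the cosets \<open>{\<one>, -\<one>} #> a = {a, -a}\<close>, multiplied as sets, which is the
  quotient loop because \<open>\<one>\<close> and \<open>-\<one>\<close> are central scalars.\<close>

definition paige_loop :: "('a, 'b) ring_scheme \<Rightarrow> 'a cd_mat set monoid" where
  "paige_loop R =
     unit_norm_loop R Mod
       {\<one>\<^bsub>cayley_dickson R\<^esub>, (\<ominus>\<^bsub>R\<^esub> \<one>\<^bsub>R\<^esub>) \<odot>\<^bsub>cayley_dickson R\<^esub> \<one>\<^bsub>cayley_dickson R\<^esub>}"

abbreviation Paige :: "('a, 'b) ring_scheme \<Rightarrow> 'a set \<Rightarrow> 'a cd_mat set monoid" where
  "Paige A F \<equiv> paige_loop (A\<lparr>carrier := F\<rparr>)"

text \<open>For structures that are loops themselves (such as Paige loops), agreement of the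
  operations on the smaller carrier makes \<open>M\<close> a subloop of \<open>N\<close>.\<close>

definition subloop_of :: "'a monoid \<Rightarrow> 'a monoid \<Rightarrow> bool" where
  "subloop_of M N \<longleftrightarrow>
     carrier M \<subseteq> carrier N \<and> \<one>\<^bsub>M\<^esub> = \<one>\<^bsub>N\<^esub> \<and>
     (\<forall>x\<in>carrier M. \<forall>y\<in>carrier M. x \<otimes>\<^bsub>M\<^esub> y = x \<otimes>\<^bsub>N\<^esub> y)"

definition proper_subloop_of :: "'a monoid \<Rightarrow> 'a monoid \<Rightarrow> bool" where
  "proper_subloop_of M N \<longleftrightarrow> subloop_of M N \<and> M \<noteq> N"


section \<open>The sets in correspondence\<close>

definition Sigma_fields :: "('a, 'b) ring_scheme \<Rightarrow> 'a set \<Rightarrow> 'a set \<Rightarrow> 'a set set" where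
  "Sigma_fields A \<Delta> P = {F. F \<subseteq> P \<and> galois_extension A \<Delta> F}"

definition Sigma_loops :: "('a, 'b) ring_scheme \<Rightarrow> 'a set \<Rightarrow> 'a set \<Rightarrow> 'a cd_mat set monoid set" where
  "Sigma_loops A \<Delta> P = Paige A ` Sigma_fields A \<Delta> P"

text \<open>The intermediate fields \<open>F\<close> here are not required to be Galois over \<open>\<Delta>\<close>.\<close>

definition Sigma_groups :: "('a, 'b) ring_scheme \<Rightarrow> 'a set \<Rightarrow> 'a set \<Rightarrow> ('a \<Rightarrow> 'a) set set" where
  "Sigma_groups A \<Delta> P =
     {H. H \<lhd> field_Aut A P \<and>
         (\<exists>F. subfield F A \<and> \<Delta> \<subseteq> F \<and> F \<subseteq> P \<and> H = galois_group A P F)}"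

end

theory Submission
  imports Defs
begin

text \<open>
  Two independent facts combine. First, a Paige loop remembers its field: every element \<open>x\<close> of
  \<open>F\<close> is an entry of a norm 1 matrix over \<open>F\<close>, and the entries of norm 1 matrices over \<open>F'\<close> lie in
  \<open>F'\<close>. Hence \<open>M(F) \<subseteq> M(F')\<close> holds exactly if \<open>F \<subseteq> F'\<close> (\<open>subloop_of_Paige_iff\<close>), and loops may be
  exchanged for fields throughout. Secondly, the fields in question obey the Galois
  correspondence for algebraic extensions of possibly infinite degree.

  For the latter everything takes place inside the algebraically closed field \<open>A\<close>. An embedding
  of a subfield into \<open>A\<close> extends along a simple extension as soon as the image of the minimal
  polynomial has a root, so by Zorn's lemma it extends along any algebraic extension
  (\<open>extend_embedding\<close>). Normality of \<open>P\<close> means that \<open>P\<close> contains all conjugates of its elements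
  (\<open>normal_extension_iff\<close>), so that embeddings of \<open>P\<close> are automorphisms of \<open>P\<close>
  (\<open>normal_extension_embedding_image\<close>). Therefore the Galois group moves an element to each of its
  conjugates (\<open>conjugate_by_field_Aut\<close>). By separability an element outside \<open>F\<close> has a conjugate over
  \<open>F\<close> other than itself, so \<open>P\<^sup>H = F\<close> for \<open>H = G(P/F)\<close> (\<open>fixed_field_galois_group\<close>). This makes
  \<open>F \<mapsto> G(P/F)\<close> injective and inclusion-reversing in both directions.

  It remains to match Galois extensions with normal subgroups. As \<open>\<Delta>\<close> is a prime field, every
  automorphism fixes its elements (\<open>hom_fixes_prime_field\<close>). If \<open>F\<close> is Galois, restriction to \<open>F\<close> is therefore
  a surjective group homomorphism \<open>Aut P \<longrightarrow> Aut F\<close> with kernel \<open>G(P/F)\<close>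
  (\<open>restriction_group_hom\<close>), which gives both normality of the kernel and the isomorphism
  \<open>Aut F \<cong> Aut P/G(P/F)\<close>. Conversely, if \<open>G(P/F)\<close> is normal in \<open>Aut P\<close>, then conjugates of elements
  of \<open>F\<close> are fixed by \<open>G(P/F)\<close> and so lie in \<open>F\<close>, which makes \<open>F\<close> Galois
  (\<open>galois_of_normal_galois_group\<close>).
\<close>

section \<open>Extending embeddings of fields\<close>

lemma (in field) subfield_hom_ring:
  assumes "subfield E R" "\<tau> \<in> ring_hom (R\<lparr>carrier := E\<rparr>) R"
  shows "ring_hom_ring (R\<lparr>carrier := E\<rparr>) R \<tau>"
  using assms subring_is_ring[OF subfieldE(1)[OF assms(1)]] ring_axioms
  by (simp add: ring_hom_ringI2)

lemma (in field) subfield_hom_inj: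
  assumes "subfield E R" "\<tau> \<in> ring_hom (R\<lparr>carrier := E\<rparr>) R"
  shows "inj_on \<tau> E"
  using non_trivial_field_hom_is_inj[OF assms(2) subfield_iff(2)[OF assms(1)]] field_axioms
  by simp

lemma (in field) subfield_polynomial:
  assumes "subfield E R" "p \<in> carrier (E[X])"
  shows "set p \<subseteq> E"
  using assms by (simp add: polynomial_incl univ_poly_carrier)

text \<open>For \<open>\<tau>\<close> an embedding of \<open>E\<close>, this is the homomorphism
  \<open>E[X] \<longrightarrow> R\<close> that applies \<open>\<tau>\<close> to the coefficients and sends the variable to \<open>y\<close>.
  Extensions of \<open>\<tau>\<close> to \<open>E(x)\<close> arise from it by passing to the quotient.\<close>

lemma (in field) eval_map_hom:
  assumes E: "subfield E R" and \<tau>: "\<tau> \<in> ring_hom (R\<lparr>carrier := E\<rparr>) R" and y: "y \<in> carrier R"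
  shows "(\<lambda>p. eval (map \<tau> p) y) \<in> ring_hom (E[X]) R"
proof (rule ring_hom_memI)
  interpret h: ring_hom_ring "R\<lparr>carrier := E\<rparr>" R \<tau>
    by (rule subfield_hom_ring[OF E \<tau>])
  note sub = subfieldE(1)[OF E]
  have set_map: "set (map \<tau> p) \<subseteq> carrier R" if "set p \<subseteq> E" for p
    using that h.hom_closed by auto
  fix p assume p: "p \<in> carrier (E[X])"
  show "eval (map \<tau> p) y \<in> carrier R"
    using eval_in_carrier set_map subfield_polynomial[OF E p] y by blast
  fix q assume q: "q \<in> carrier (E[X])"
  note sets = subfield_polynomial[OF E p] subfield_polynomial[OF E q]
  have "normalize (map \<tau> (poly_mult p q)) = poly_mult (map \<tau> p) (map \<tau> q)"
    using h.poly_mult_hom'[of p q] sets by (simp add: poly_mult_consistent[OF sub])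
  moreover have "set (poly_mult p q) \<subseteq> E"
    using subfield_polynomial[OF E, of "p \<otimes>\<^bsub>E[X]\<^esub> q"] p q
      monoid.m_closed[OF univ_poly_is_monoid[OF sub]] by (simp add: univ_poly_mult)
  ultimately show "eval (map \<tau> (p \<otimes>\<^bsub>E[X]\<^esub> q)) y = eval (map \<tau> p) y \<otimes> eval (map \<tau> q) y"
    using eval_poly_mult[OF set_map set_map y, of p q] sets eval_normalize[OF set_map y]
    by (metis univ_poly_mult)
  have "normalize (map \<tau> (poly_add p q)) = poly_add (map \<tau> p) (map \<tau> q)"
    using h.poly_add_hom'[of p q] sets by (simp add: poly_add_consistent[OF sub] del: poly_add.simps)
  moreover have "set (poly_add p q) \<subseteq> E"
    using subfield_polynomial[OF E, of "p \<oplus>\<^bsub>E[X]\<^esub> q"] p q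
      ring.ring_simprules(1)[OF univ_poly_is_ring[OF sub]] by (simp add: univ_poly_add del: poly_add.simps)
  ultimately show "eval (map \<tau> (p \<oplus>\<^bsub>E[X]\<^esub> q)) y = eval (map \<tau> p) y \<oplus> eval (map \<tau> q) y"
    using eval_poly_add[OF set_map set_map y, of p q] sets eval_normalize[OF set_map y]
    by (metis univ_poly_add)
next
  interpret h: ring_hom_ring "R\<lparr>carrier := E\<rparr>" R \<tau>
    by (rule subfield_hom_ring[OF E \<tau>])
  show "eval (map \<tau> \<one>\<^bsub>E[X]\<^esub>) y = \<one>"
    using h.hom_one y by (simp add: univ_poly_one)
qed

text \<open>The evaluation at \<open>x\<close> maps \<open>E[X]\<close> onto \<open>E(x)\<close>, and its kernel is
  generated by the minimal polynomial of \<open>x\<close>. The twisted evaluation at \<open>y\<close> kills that generator, so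
  it factors through \<open>E(x)\<close>; the induced map is the extension.\<close>

lemma (in field) hom_extend_simple:
  assumes E: "subfield E R" and \<tau>: "\<tau> \<in> ring_hom (R\<lparr>carrier := E\<rparr>) R"
    and x: "x \<in> carrier R" "(algebraic over E) x"
    and y: "y \<in> carrier R" "eval (map \<tau> (Irr E x)) y = \<zero>"
  obtains \<tau>' where "\<tau>' \<in> ring_hom (R\<lparr>carrier := simple_extension E x\<rparr>) R"
    "\<And>e. e \<in> E \<Longrightarrow> \<tau>' e = \<tau> e" "\<tau>' x = y"
proof -
  note sub = subfieldE(1)[OF E]
  define ev where "ev = (\<lambda>p. eval (map \<tau> p) y)"
  interpret UP: domain "E[X]" by (rule univ_poly_is_domain[OF sub])
  interpret h: ring_hom_ring "E[X]" R ev
    unfolding ev_def using eval_map_hom[OF E \<tau> y(1)] UP.ring_axioms ring_axioms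
    by (simp add: ring_hom_ringI2)
  interpret k: ring_hom_ring "E[X]" R "\<lambda>p. eval p x"
    using eval_ring_hom[OF sub x(1)] .
  note irr = IrrE[OF E x]
  have ker: "ev p = \<zero>" if p: "p \<in> carrier (E[X])" "eval p x = \<zero>" for p
  proof -
    have "Irr E x divides\<^bsub>E[X]\<^esub> p"
      using Irr_minimal[OF E x p] pdivides_iff_shell[OF E irr(1) p(1)] by simp
    then obtain r where r: "r \<in> carrier (E[X])" "p = Irr E x \<otimes>\<^bsub>E[X]\<^esub> r"
      by (auto simp: factor_def)
    then have "ev p = ev (Irr E x) \<otimes> ev r" using irr(1) by simp
    moreover have "ev (Irr E x) = \<zero>" using y(2) by (simp add: ev_def)
    ultimately show ?thesis using h.hom_closed[OF r(1)] by simp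
  qed
  have wd: "ev p = ev q" if "p \<in> carrier (E[X])" "q \<in> carrier (E[X])" "eval p x = eval q x" for p q
  proof -
    have "ev (p \<ominus>\<^bsub>E[X]\<^esub> q) = \<zero>"
      using that ker[of "p \<ominus>\<^bsub>E[X]\<^esub> q"] k.hom_closed[OF that(2)]
        k.hom_add[of p "\<ominus>\<^bsub>E[X]\<^esub> q"] k.hom_a_inv[OF that(2)] r_neg
      unfolding a_minus_def by (metis UP.add.inv_closed UP.add.m_closed)
    then have "ev p \<oplus> \<ominus> ev q = \<zero>"
      using that h.hom_add[of p "\<ominus>\<^bsub>E[X]\<^esub> q"] h.hom_a_inv[OF that(2)]
      unfolding a_minus_def by (metis UP.add.inv_closed)
    then show ?thesis
      using h.hom_closed that minus_equality minus_minus by (metis a_inv_closed)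
  qed
  define \<tau>' where "\<tau>' z = ev (SOME p. p \<in> carrier (E[X]) \<and> eval p x = z)" for z
  have val: "\<tau>' (eval p x) = ev p" if "p \<in> carrier (E[X])" for p
    unfolding \<tau>'_def by (rule someI2[of _ p]) (use that in simp, use that wd in blast)
  have img: "simple_extension E x = (\<lambda>p. eval p x) ` carrier (E[X])"
    by (rule simple_extension_as_eval_img[OF subfieldE(3)[OF E] x(1)])
  have "\<tau>' \<in> ring_hom (R\<lparr>carrier := simple_extension E x\<rparr>) R"
  proof (rule ring_hom_memI)
    fix a assume a: "a \<in> carrier (R\<lparr>carrier := simple_extension E x\<rparr>)"
    then obtain p where p: "p \<in> carrier (E[X])" "a = eval p x" using img by auto
    show "\<tau>' a \<in> carrier R" using p val by simp
    fix b assume b: "b \<in> carrier (R\<lparr>carrier := simple_extension E x\<rparr>)"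
    then obtain q where q: "q \<in> carrier (E[X])" "b = eval q x" using img by auto
    show "\<tau>' (a \<otimes>\<^bsub>R\<lparr>carrier := simple_extension E x\<rparr>\<^esub> b) = \<tau>' a \<otimes> \<tau>' b"
      using p q val[of "p \<otimes>\<^bsub>E[X]\<^esub> q"] val by simp
    show "\<tau>' (a \<oplus>\<^bsub>R\<lparr>carrier := simple_extension E x\<rparr>\<^esub> b) = \<tau>' a \<oplus> \<tau>' b"
      using p q val[of "p \<oplus>\<^bsub>E[X]\<^esub> q"] val by simp
  next
    show "\<tau>' \<one>\<^bsub>R\<lparr>carrier := simple_extension E x\<rparr>\<^esub> = \<one>"
      using val[of "\<one>\<^bsub>E[X]\<^esub>"] by simp
  qed
  moreover have "\<tau>' e = \<tau> e" if e: "e \<in> E" for e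
  proof -
    interpret t: ring_hom_ring "R\<lparr>carrier := E\<rparr>" R \<tau>
      by (rule subfield_hom_ring[OF E \<tau>])
    have eR: "e \<in> carrier R" "\<tau> e \<in> carrier R"
      using e subfieldE(3)[OF E] t.hom_closed by auto
    show ?thesis
    proof (cases "e = \<zero>")
      case True
      then show ?thesis using val[OF univ_poly_zero_closed] t.hom_zero by (simp add: ev_def)
    next
      case False
      then have "[e] \<in> carrier (E[X])"
        using e by (simp add: const_is_polynomial flip: univ_poly_carrier)
      then show ?thesis using val[of "[e]"] eR y by (simp add: ev_def)
    qed
  qed
  moreover have "\<tau>' x = y"
  proof -
    interpret t: ring_hom_ring "R\<lparr>carrier := E\<rparr>" R \<tau>
      by (rule subfield_hom_ring[OF E \<tau>])
    show ?thesis
      using val[OF var_closed(1)[OF sub]] eval_var[OF x(1)] y t.hom_one t.hom_zero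
      by (simp add: ev_def var_def)
  qed
  ultimately show thesis using that by blast
qed

text \<open>The graphs of the embeddings of subfields into the ambient field.
  Graphs are ordered by inclusion exactly as embeddings are ordered by extension, and every clause
  speaks of at most two elements of the graph, so it passes to unions of chains. The last clause
  constrains the domain only: the values at negatives and inverses are determined by the clauses for
  products and sums.\<close>

definition (in ring) partial_embedding :: "('a \<times> 'a) set \<Rightarrow> bool" where
  "partial_embedding G \<longleftrightarrow>
     G \<subseteq> carrier R \<times> carrier R \<and> single_valued G \<and> (\<one>, \<one>) \<in> G \<and>
     (\<forall>x y x' y'. (x, y) \<in> G \<longrightarrow> (x', y') \<in> G \<longrightarrow>
        (x \<otimes> x', y \<otimes> y') \<in> G \<and> (x \<oplus> x', y \<oplus> y') \<in> G) \<and>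
     (\<forall>x \<in> Domain G. \<ominus> x \<in> Domain G \<and> (x \<noteq> \<zero> \<longrightarrow> inv x \<in> Domain G))"

lemma (in field) partial_embedding_graph:
  assumes E: "subfield E R" and \<tau>: "\<tau> \<in> ring_hom (R\<lparr>carrier := E\<rparr>) R"
  shows "partial_embedding ((\<lambda>x. (x, \<tau> x)) ` E)"
proof -
  note subE = subringE[OF subfieldE(1)[OF E]]
  have hom: "\<tau> x \<in> carrier R" "\<tau> (x \<otimes> y) = \<tau> x \<otimes> \<tau> y" "\<tau> (x \<oplus> y) = \<tau> x \<oplus> \<tau> y"
    if "x \<in> E" "y \<in> E" for x y
    using that ring_hom_memE(1-3)[OF \<tau>] by auto
  have "\<tau> \<one> = \<one>" using ring_hom_memE(4)[OF \<tau>] by simp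
  then show ?thesis
    using subE hom subfield_m_inv(1)[OF E]
    unfolding partial_embedding_def single_valued_def Domain_fst by (auto simp: image_iff)
qed

lemma (in field) partial_embeddingE:
  assumes G: "partial_embedding G"
  obtains \<tau> where "subfield (Domain G) R" "\<tau> \<in> ring_hom (R\<lparr>carrier := Domain G\<rparr>) R"
    "G = (\<lambda>x. (x, \<tau> x)) ` Domain G"
proof
  show "subfield (Domain G) R"
    using G by (intro subfieldI' subringI) (auto simp: partial_embedding_def, blast+)
  define \<tau> where "\<tau> x = (THE y. (x, y) \<in> G)" for x
  have \<tau>: "\<tau> x = y" if "(x, y) \<in> G" for x y
    using that G by (auto simp: \<tau>_def partial_embedding_def single_valued_def)
  show "\<tau> \<in> ring_hom (R\<lparr>carrier := Domain G\<rparr>) R"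
  proof (rule ring_hom_memI)
    fix x assume "x \<in> carrier (R\<lparr>carrier := Domain G\<rparr>)"
    then obtain y where xy: "(x, y) \<in> G" by auto
    then show "\<tau> x \<in> carrier R" using G \<tau> by (auto simp: partial_embedding_def)
    fix x' assume "x' \<in> carrier (R\<lparr>carrier := Domain G\<rparr>)"
    then obtain y' where xy': "(x', y') \<in> G" by auto
    have "(x \<otimes> x', y \<otimes> y') \<in> G" "(x \<oplus> x', y \<oplus> y') \<in> G"
      using G xy xy' by (auto simp: partial_embedding_def)
    then show "\<tau> (x \<otimes>\<^bsub>R\<lparr>carrier := Domain G\<rparr>\<^esub> x') = \<tau> x \<otimes> \<tau> x'"
      "\<tau> (x \<oplus>\<^bsub>R\<lparr>carrier := Domain G\<rparr>\<^esub> x') = \<tau> x \<oplus> \<tau> x'"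
      using xy xy' by (simp_all add: \<tau>)
  next
    show "\<tau> \<one>\<^bsub>R\<lparr>carrier := Domain G\<rparr>\<^esub> = \<one>"
      using G by (simp add: \<tau> partial_embedding_def)
  qed
  show "G = (\<lambda>x. (x, \<tau> x)) ` Domain G"
    using \<tau> by force
qed

lemma (in ring) partial_embedding_Union:
  assumes C: "C \<noteq> {}" "\<And>G. G \<in> C \<Longrightarrow> partial_embedding G"
    and chain: "\<And>G H. G \<in> C \<Longrightarrow> H \<in> C \<Longrightarrow> G \<subseteq> H \<or> H \<subseteq> G"
  shows "partial_embedding (\<Union>C)"
proof -
  have two: "\<exists>G\<in>C. a \<in> G \<and> b \<in> G" if "a \<in> \<Union>C" "b \<in> \<Union>C" for a b
    using that chain by blast
  have "\<Union>C \<subseteq> carrier R \<times> carrier R"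
    using C(2) unfolding partial_embedding_def by blast
  moreover have "(\<one>, \<one>) \<in> \<Union>C"
    using C unfolding partial_embedding_def by blast
  moreover have "single_valued (\<Union>C)"
  proof (rule single_valuedI)
    fix x y z assume "(x, y) \<in> \<Union>C" "(x, z) \<in> \<Union>C"
    from two[OF this] show "y = z"
      using C(2) unfolding partial_embedding_def by (meson single_valuedD)
  qed
  moreover have "(x \<otimes> x', y \<otimes> y') \<in> \<Union>C \<and> (x \<oplus> x', y \<oplus> y') \<in> \<Union>C"
    if xy: "(x, y) \<in> \<Union>C" "(x', y') \<in> \<Union>C" for x y x' y'
  proof -
    obtain G where "G \<in> C" "(x, y) \<in> G" "(x', y') \<in> G" using two[OF xy] by blast
    then show ?thesis using C(2)[of G] unfolding partial_embedding_def by blast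
  qed
  moreover have "\<ominus> x \<in> Domain (\<Union>C) \<and> (x \<noteq> \<zero> \<longrightarrow> inv x \<in> Domain (\<Union>C))" if x: "x \<in> Domain (\<Union>C)" for x
  proof -
    obtain G where "G \<in> C" "x \<in> Domain G" using x by blast
    then show ?thesis using C(2)[of G] unfolding partial_embedding_def by blast
  qed
  ultimately show ?thesis unfolding partial_embedding_def by blast
qed

text \<open>An embedding is injective and thus preserves degrees, so the
  image of a nonconstant polynomial is nonconstant and has a root.\<close>

lemma (in algebraically_closed) exists_root_of_hom_image:
  assumes E: "subfield E L" and \<tau>: "\<tau> \<in> ring_hom (L\<lparr>carrier := E\<rparr>) L"
    and p: "p \<in> carrier (E[X])" "length p > 1"
  obtains y where "y \<in> carrier L" "eval (map \<tau> p) y = \<zero>"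
proof -
  have "map \<tau> p \<in> carrier (poly_ring L)"
    using polynomial_hom[OF \<tau> subfield_iff(2)[OF E] field_axioms] p
    by (simp add: univ_poly_consistent[OF subfieldE(1)[OF E]])
  moreover from this have "roots (map \<tau> p) \<noteq> {#}"
    using roots_over_carrier[of "map \<tau> p"] p(2) unfolding splitted_def by auto
  ultimately show thesis
    using that roots_mem_iff_is_root[of "map \<tau> p"] unfolding is_root_def
    by (metis multiset_nonemptyE)
qed

text \<open>Zorn's lemma yields a maximal extension of the embedding. Were some
  \<open>x \<in> P\<close> outside its domain \<open>E\<close>, the image of the minimal polynomial of \<open>x\<close> over \<open>E\<close> would have a root
  in the algebraically closed field, and the embedding would extend to \<open>E(x)\<close>.\<close>

lemma (in algebraically_closed) extend_embedding:
  assumes K: "subfield K L" and P: "subfield P L" "K \<subseteq> P"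
    and alg: "\<And>x. x \<in> P \<Longrightarrow> (algebraic over K) x"
    and \<psi>: "\<psi> \<in> ring_hom (L\<lparr>carrier := K\<rparr>) L"
  obtains \<phi> where "\<phi> \<in> ring_hom (L\<lparr>carrier := P\<rparr>) L" "\<And>x. x \<in> K \<Longrightarrow> \<phi> x = \<psi> x"
proof -
  let ?\<psi> = "(\<lambda>x. (x, \<psi> x)) ` K"
  define \<A> where "\<A> = {G. partial_embedding G \<and> Domain G \<subseteq> P \<and> ?\<psi> \<subseteq> G}"
  have "?\<psi> \<in> \<A>"
    using partial_embedding_graph[OF K \<psi>] P(2) by (auto simp: \<A>_def)
  then have "\<A> \<noteq> {}" by blast
  moreover have "\<Union>C \<in> \<A>" if C: "C \<noteq> {}" "subset.chain \<A> C" for C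
  proof -
    have "C \<subseteq> \<A>" "\<And>G H. G \<in> C \<Longrightarrow> H \<in> C \<Longrightarrow> G \<subseteq> H \<or> H \<subseteq> G"
      using C(2) by (auto simp: subset_chain_def)
    then show ?thesis
      using C(1) partial_embedding_Union[of C] unfolding \<A>_def by blast
  qed
  ultimately obtain M where M: "M \<in> \<A>" "\<And>G. G \<in> \<A> \<Longrightarrow> M \<subseteq> G \<Longrightarrow> G = M"
    using subset_Zorn_nonempty[of \<A>] by metis
  then have "partial_embedding M" by (simp add: \<A>_def)
  then obtain \<tau> where E: "subfield (Domain M) L"
    and \<tau>: "\<tau> \<in> ring_hom (L\<lparr>carrier := Domain M\<rparr>) L" and graph: "M = (\<lambda>x. (x, \<tau> x)) ` Domain M"
    using partial_embeddingE by blast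
  define E where "E = Domain M"
  note E = E[folded E_def] and \<tau> = \<tau>[folded E_def] and graph = graph[folded E_def]
  have incl: "K \<subseteq> E" "E \<subseteq> P" and ext: "\<And>x. x \<in> K \<Longrightarrow> \<tau> x = \<psi> x"
  proof -
    have M': "Domain M \<subseteq> P" "(\<lambda>x. (x, \<psi> x)) ` K \<subseteq> M" using M(1) by (auto simp: \<A>_def)
    then show "E \<subseteq> P" by (simp add: E_def)
    have "x \<in> E \<and> \<tau> x = \<psi> x" if "x \<in> K" for x
    proof -
      have "(x, \<psi> x) \<in> (\<lambda>x. (x, \<tau> x)) ` E" using M'(2) that graph by blast
      then show ?thesis by auto
    qed
    then show "K \<subseteq> E" "\<And>x. x \<in> K \<Longrightarrow> \<tau> x = \<psi> x" by auto
  qed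
  have "P \<subseteq> E"
  proof
    fix x assume x: "x \<in> P"
    then have xL: "x \<in> carrier L" using subfieldE(3)[OF P(1)] by blast
    have xE: "(algebraic over E) x" using algebraic_mono[OF incl(1)] alg[OF x] by blast
    note irr = IrrE[OF E xL xE]
    have "length (Irr E x) > 1"
      using pirreducible_degree[OF E irr(1,2)] by linarith
    from exists_root_of_hom_image[OF E \<tau> irr(1) this]
    obtain y where "y \<in> carrier L" "eval (map \<tau> (Irr E x)) y = \<zero>" .
    from hom_extend_simple[OF E \<tau> xL xE this]
    obtain \<tau>' where \<tau>': "\<tau>' \<in> ring_hom (L\<lparr>carrier := simple_extension E x\<rparr>) L"
      and eq: "\<And>e. e \<in> E \<Longrightarrow> \<tau>' e = \<tau> e" by metis
    let ?E' = "simple_extension E x"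
    (* the graph of the extended embedding competes with the maximal one *)
    let ?M' = "(\<lambda>x. (x, \<tau>' x)) ` ?E'"
    have E': "subfield ?E' L" using simple_extension_is_subfield[OF E xL] xE by blast
    have "E \<subseteq> ?E'" using simple_extension_incl[OF subfieldE(3)[OF E] xL] .
    then have "M \<subseteq> ?M'" using graph eq by fastforce
    moreover have "?E' \<subseteq> P"
      using simple_extension_subring_incl[OF subfieldE(1)[OF P(1)] incl(2) x] .
    then have "?M' \<in> \<A>"
      using partial_embedding_graph[OF E' \<tau>'] M(1) \<open>M \<subseteq> ?M'\<close>
      unfolding \<A>_def by (auto simp: Domain_fst)
    ultimately have "?M' = M" using M(2) by blast
    then have "Domain ?M' = E" by (simp add: E_def)
    then show "x \<in> E"
      using simple_extension_mem[OF subfieldE(1)[OF E] xL] by (force simp: Domain_fst)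
  qed
  with incl have "E = P" by blast
  then show thesis using that \<tau> ext by blast
qed


section \<open>Normal extensions and conjugates\<close>

lemma (in ring) subring_a_inv:
  assumes "subring F R" "a \<in> F"
  shows "\<ominus>\<^bsub>R\<lparr>carrier := F\<rparr>\<^esub> a = \<ominus> a"
  using add.m_inv_consistent[OF subring.axioms(1)[OF assms(1)] assms(2)]
  by (simp add: a_inv_def)

text \<open>Divisibility of polynomials over \<open>F\<close> does not depend on whether
  the quotient is sought over \<open>F\<close> or over the ambient field, because division with remainder takes
  place over \<open>F\<close>.\<close>

lemma (in field) alg_mult_subfield:
  assumes F: "subfield F R" and p: "p \<in> carrier (F[X])" and a: "a \<in> F"
  shows "ring.alg_mult (R\<lparr>carrier := F\<rparr>) p a = alg_mult p a"
proof -
  note sub = subfieldE(1)[OF F]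
  interpret F: field "R\<lparr>carrier := F\<rparr>" by (rule subfield_iff(2)[OF F])
  interpret UP: domain "F[X]" by (rule univ_poly_is_domain[OF sub])
  have lin: "[\<one>, \<ominus> a] \<in> carrier (F[X])"
    using subringE(3,5)[OF sub] a by (simp add: polynomial_def flip: univ_poly_carrier)
  have pow: "[\<one>, \<ominus> a] [^]\<^bsub>F[X]\<^esub> n = [\<one>, \<ominus> a] [^]\<^bsub>poly_ring R\<^esub> n" for n :: nat
    by (simp add: nat_pow_def univ_poly_mult univ_poly_one)
  have "([\<one>, \<ominus> a] [^]\<^bsub>F[X]\<^esub> n) pdivides\<^bsub>R\<lparr>carrier := F\<rparr>\<^esub> p \<longleftrightarrow>
      ([\<one>, \<ominus> a] [^]\<^bsub>poly_ring R\<^esub> n) pdivides p" for n :: nat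
    using pdivides_iff_shell[OF F UP.nat_pow_closed[OF lin] p]
    by (simp add: pdivides_def[of "R\<lparr>carrier := F\<rparr>"] univ_poly_consistent[OF sub] pow)
  then show ?thesis
    using a subfieldE(3)[OF F]
    by (auto simp: alg_mult_def F.alg_mult_def univ_poly_consistent[OF sub] subring_a_inv[OF sub])
qed

lemma (in field) roots_subfield:
  assumes F: "subfield F R" and p: "p \<in> carrier (F[X])"
  shows "ring.roots (R\<lparr>carrier := F\<rparr>) p = filter_mset (\<lambda>a. a \<in> F) (roots p)"
proof (rule multiset_eqI)
  fix a
  note sub = subfieldE(1)[OF F]
  interpret F: field "R\<lparr>carrier := F\<rparr>" by (rule subfield_iff(2)[OF F])
  have "p \<in> carrier (poly_ring (R\<lparr>carrier := F\<rparr>))" "p \<in> carrier (poly_ring R)"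
    using p carrier_polynomial_shell[OF sub] by (auto simp: univ_poly_consistent[OF sub])
  then show "count (F.roots p) a = count (filter_mset (\<lambda>a. a \<in> F) (roots p)) a"
    using alg_mult_subfield[OF F p]
    by (auto simp flip: F.alg_mult_eq_count_roots alg_mult_eq_count_roots) (simp add: F.alg_mult_def)
qed

text \<open>Over the ambient field the polynomial has as many roots as its
  degree, counted with multiplicity; over \<open>F\<close> it has those of them that lie in \<open>F\<close>, with the same
  multiplicities.\<close>

lemma (in algebraically_closed) splitted_subfield_iff:
  assumes F: "subfield F L" and p: "p \<in> carrier (F[X])" "p \<noteq> []"
  shows "ring.splitted (L\<lparr>carrier := F\<rparr>) p \<longleftrightarrow> (\<forall>y \<in> carrier L. eval p y = \<zero> \<longrightarrow> y \<in> F)"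
proof -
  interpret F: field "L\<lparr>carrier := F\<rparr>" by (rule subfield_iff(2)[OF F])
  have pL: "p \<in> carrier (poly_ring L)"
    using p carrier_polynomial_shell[OF subfieldE(1)[OF F]] by blast
  let ?in = "filter_mset (\<lambda>a. a \<in> F) (roots p)" and ?out = "filter_mset (\<lambda>a. a \<notin> F) (roots p)"
  have "size ?in + size ?out = length p - 1"
    using roots_over_carrier[OF pL] multiset_partition[of "roots p" "\<lambda>a. a \<in> F"]
    by (metis size_union splitted_def)
  then have "F.splitted p \<longleftrightarrow> size ?out = 0"
    unfolding F.splitted_def roots_subfield[OF F p(1)] by linarith
  also have "\<dots> \<longleftrightarrow> ?out = {#}" by (rule size_eq_0_iff_empty)
  also have "\<dots> \<longleftrightarrow> set_mset ?out = {}" by simp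
  also have "\<dots> \<longleftrightarrow> (\<forall>y \<in># roots p. y \<in> F)" by (simp only: set_mset_filter) blast
  finally show ?thesis
    using p(2) roots_mem_iff_is_root[OF pL] by (auto simp: is_root_def)
qed

text \<open>An irreducible polynomial that vanishes at \<open>x\<close> is a constant
  multiple of the minimal polynomial of \<open>x\<close>.\<close>

lemma (in domain) pirreducible_root_Irr:
  assumes K: "subfield K R" and x: "x \<in> carrier R"
    and p: "p \<in> carrier (K[X])" "pirreducible K p" "eval p x = \<zero>"
    and y: "y \<in> carrier R" "eval p y = \<zero>"
  shows "eval (Irr K x) y = \<zero>"
proof -
  note sub = subfieldE(1)[OF K]
  have "p \<noteq> []" using pirreducibleE(1)[OF sub p(1,2)] .
  then have alg: "(algebraic over K) x" using algebraicI[OF p(1) _ p(3)] by blast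
  note irr = IrrE[OF K x alg]
  interpret UP: domain "K[X]" by (rule univ_poly_is_domain[OF sub])
  have "Irr K x divides\<^bsub>K[X]\<^esub> p"
    using Irr_minimal[OF K x alg p(1,3)] pdivides_iff_shell[OF K irr(1) p(1)] by simp
  then obtain r where r: "r \<in> carrier (K[X])" "p = Irr K x \<otimes>\<^bsub>K[X]\<^esub> r"
    by (auto simp: factor_def)
  have "Irr K x \<notin> Units (K[X])" using pirreducibleE(2)[OF sub irr(1,2)] .
  then have "r \<in> Units (K[X])" using pirreducibleE(3)[OF sub p(1,2) irr(1) r] by blast
  then obtain k where k: "k \<in> K" "k \<noteq> \<zero>" "r = [k]" using univ_poly_units[OF K] by auto
  have kR: "k \<in> carrier R" using k subfieldE(3)[OF K] by blast
  have "eval (Irr K x) y \<otimes> k = \<zero>"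
    using y ring_hom_memE(2)[OF eval_is_hom[OF sub y(1)] irr(1) r(1)] r(2) k kR by simp
  moreover have "eval (Irr K x) y \<in> carrier R"
    using ring_hom_memE(1)[OF eval_is_hom[OF sub y(1)] irr(1)] .
  ultimately show ?thesis using integral[of _ k] kR k by blast
qed

text \<open>This replaces splitting over \<open>E\<close>, which refers to the
  polynomial ring of a smaller field, by a condition on elements of the ambient field alone: \<open>E\<close>
  contains all conjugates of its elements.\<close>

lemma (in algebraically_closed) normal_extension_iff:
  "normal_extension L K E \<longleftrightarrow> algebraic_extension L K E \<and>
     (\<forall>x \<in> E. \<forall>y \<in> carrier L. eval (Irr K x) y = \<zero> \<longrightarrow> y \<in> E)"
proof (cases "algebraic_extension L K E")
  case True
  then have K: "subfield K L" and E: "subfield E L" and "K \<subseteq> E"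
    and alg: "\<And>x. x \<in> E \<Longrightarrow> (algebraic over K) x"
    by (auto simp: algebraic_extension_def field_extension_def)
  note subK = subfieldE(1)[OF K]
  have EL: "E \<subseteq> carrier L" by (rule subfieldE(3)[OF E])
  have spl: "ring.splitted (L\<lparr>carrier := E\<rparr>) p \<longleftrightarrow> (\<forall>y \<in> carrier L. eval p y = \<zero> \<longrightarrow> y \<in> E)"
    if p: "p \<in> carrier (K[X])" "pirreducible K p" for p
  proof (rule splitted_subfield_iff[OF E])
    show "p \<in> carrier (E[X])"
      using p(1) \<open>K \<subseteq> E\<close> by (auto simp: polynomial_def simp flip: univ_poly_carrier)
    show "p \<noteq> []" using pirreducibleE(1)[OF subK p] .
  qed
  show ?thesis
  proof safe
    fix x y assume n: "normal_extension L K E" and x: "x \<in> E"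
      and y: "y \<in> carrier L" "eval (Irr K x) y = \<zero>"
    have "x \<in> carrier L" using x EL by blast
    note irr = IrrE[OF K this alg[OF x]]
    have "ring.splitted (L\<lparr>carrier := E\<rparr>) (Irr K x)"
      using n irr(1,2,4) x unfolding normal_extension_def by blast
    then show "y \<in> E" using spl[OF irr(1,2)] y by blast
  next
    assume c: "\<forall>x \<in> E. \<forall>y \<in> carrier L. eval (Irr K x) y = \<zero> \<longrightarrow> y \<in> E"
    show "normal_extension L K E"
      unfolding normal_extension_def
    proof (intro conjI ballI impI)
      show "algebraic_extension L K E" by (rule True)
      fix p assume p: "p \<in> carrier (K[X])" "pirreducible K p" and "\<exists>x\<in>E. eval p x = \<zero>"
      then obtain x where x: "x \<in> E" "eval p x = \<zero>" by blast
      have "y \<in> E" if "y \<in> carrier L" "eval p y = \<zero>" for y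
        using c x that pirreducible_root_Irr[OF K _ p x(2)] EL by blast
      then show "ring.splitted (L\<lparr>carrier := E\<rparr>) p" using spl[OF p] by blast
    qed
  qed (rule True)
qed (simp add: normal_extension_def)


section \<open>Homomorphisms fix the prime field\<close>

lemma subfield_rat_eq_UNIV:
  assumes T: "subfield T (ring_of_type_algebra :: rat ring)"
  shows "T = UNIV"
proof -
  let ?Q = "ring_of_type_algebra :: rat ring"
  interpret field ?Q by (rule field_from_type_algebra)
  note props = subringE[OF subfieldE(1)[OF T]]
  have ops [simp]: "\<zero>\<^bsub>?Q\<^esub> = 0" "\<one>\<^bsub>?Q\<^esub> = 1" "x \<oplus>\<^bsub>?Q\<^esub> y = x + y" "x \<otimes>\<^bsub>?Q\<^esub> y = x * y"
    "carrier ?Q = UNIV" for x y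
    by (simp_all add: ring_of_type_algebra_def)
  have minus: "\<ominus>\<^bsub>?Q\<^esub> x = - x" for x
    using r_neg[of x] by (simp add: eq_neg_iff_add_eq_0 add.commute)
  have nat: "of_nat n \<in> T" for n
    using props(2,3,7) by (induction n) auto
  have int: "of_int n \<in> T" for n
  proof (cases n)
    case (nonneg m)
    then show ?thesis using nat[of m] by simp
  next
    case (neg m)
    then show ?thesis using props(5)[OF nat[of "Suc m"]] by (simp add: minus del: of_nat_Suc)
  qed
  have "q \<in> T" for q
  proof -
    obtain a b where q: "q = of_int a / of_int b" and b: "b > 0"
      using quotient_of_div quotient_of_denom_pos by (metis surj_pair)
    have "inv\<^bsub>?Q\<^esub> (of_int b) \<in> T" "of_int b * inv\<^bsub>?Q\<^esub> (of_int b) = 1"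
      using subfield_m_inv[OF T, of "of_int b"] int[of b] b by auto
    moreover from this have "inv\<^bsub>?Q\<^esub> (of_int b) = 1 / of_int b"
      using b by (simp add: field_simps)
    ultimately show ?thesis
      using props(6)[OF int[of a], of "inv\<^bsub>?Q\<^esub> (of_int b)"] q by simp
  qed
  then show ?thesis by blast
qed

lemma subring_residue_ring_eq:
  assumes "m > 1" and T: "subring T (residue_ring m)"
  shows "T = carrier (residue_ring m)"
proof
  note props = subringE[OF T]
  show "T \<subseteq> carrier (residue_ring m)" by (rule props(1))
  have nat: "int n mod m \<in> T" for n
  proof (induction n)
    case 0
    then show ?case using props(2) by (simp add: residue_ring_def)
  next
    case (Suc n)
    then have "(int n mod m + 1) mod m \<in> T"
      using props(3) props(7)[of "int n mod m" 1] by (simp add: residue_ring_def)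
    then show ?case by (simp add: mod_simps add.commute)
  qed
  show "carrier (residue_ring m) \<subseteq> T"
  proof
    fix x assume "x \<in> carrier (residue_ring m)"
    then have "x = int (nat x) mod m" by (auto simp: residue_ring_def)
    then show "x \<in> T" using nat[of "nat x"] by simp
  qed
qed

text \<open>Having no proper subfield is preserved by isomorphisms, so the two
  concrete models decide the matter.\<close>

lemma prime_field_subfield_eq:
  assumes R: "prime_field R" and S: "subfield S R"
  shows "S = carrier R"
proof -
  (* stated for an arbitrary model, as the two models have different types *)
  have step: "S = carrier R"
    if Q: "field Q" and h: "h \<in> ring_iso R Q" and triv: "\<And>T. subfield T Q \<Longrightarrow> T = carrier Q"
    for Q :: "('c, 'd) ring_scheme" and h
  proof -
    have hh: "h \<in> ring_hom R Q" "bij_betw h (carrier R) (carrier Q)"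
      using h by (auto simp: ring_iso_def)
    interpret Q: field Q by (rule Q)
    interpret R: field R using R by (simp add: prime_field_def)
    interpret h: ring_hom_ring R Q h
      using hh(1) R.ring_axioms Q.ring_axioms by (simp add: ring_hom_ringI2)
    have "h ` S = carrier Q"
      using h.img_is_subfield(2)[OF S] Q.one_not_zero triv by blast
    then have "h ` S = h ` carrier R"
      using hh(2) by (simp add: bij_betw_def)
    then show ?thesis
      using hh(2) subfieldE(3)[OF S] inj_on_image_eq_iff[of h "carrier R" S "carrier R"]
      by (simp add: bij_betw_def)
  qed
  consider "R \<simeq> (ring_of_type_algebra :: rat ring)"
    | p :: nat where "Factorial_Ring.prime p" "R \<simeq> residue_ring (int p)"
    using R by (auto simp: prime_field_def)
  then show ?thesis
  proof cases
    case 1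
    then obtain h where h: "h \<in> ring_iso R (ring_of_type_algebra :: rat ring)"
      by (auto simp: is_ring_iso_def)
    have "T = carrier (ring_of_type_algebra :: rat ring)"
      if "subfield T (ring_of_type_algebra :: rat ring)" for T
      using subfield_rat_eq_UNIV[OF that] by (simp add: ring_of_type_algebra_def)
    from step[OF field_from_type_algebra h this] show ?thesis .
  next
    case 2
    then obtain h where h: "h \<in> ring_iso R (residue_ring (int p))"
      by (auto simp: is_ring_iso_def)
    interpret p: residues_prime p "residue_ring (int p)"
      using 2 by unfold_locales (auto simp: )
    have "int p > 1" using prime_gt_1_nat[OF 2(1)] by simp
    then have "T = carrier (residue_ring (int p))" if "subfield T (residue_ring (int p))" for T
      using subring_residue_ring_eq subfieldE(1)[OF that] by blast
    from step[OF p.is_field h this] show ?thesis .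
  qed
qed

lemma (in field) subfield_subset_iff:
  assumes "subfield F R" "S \<subseteq> F"
  shows "subfield S (R\<lparr>carrier := F\<rparr>) \<longleftrightarrow> subfield S R"
proof -
  interpret F: field "R\<lparr>carrier := F\<rparr>" by (rule subfield_iff(2)[OF assms(1)])
  have "S \<subseteq> carrier R" using assms subfieldE(3) by blast
  show ?thesis
  proof
    assume "subfield S (R\<lparr>carrier := F\<rparr>)"
    from F.subfield_iff(2)[OF this] have "field (R\<lparr>carrier := S\<rparr>)" by simp
    then show "subfield S R" using subfield_iff(1) \<open>S \<subseteq> carrier R\<close> by blast
  next
    assume "subfield S R"
    from subfield_iff(2)[OF this] have "field (R\<lparr>carrier := F\<rparr>\<lparr>carrier := S\<rparr>)" by simp
    then show "subfield S (R\<lparr>carrier := F\<rparr>)" by (rule F.subfield_iff(1)) (simp add: assms(2))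
  qed
qed

text \<open>The elements of \<open>\<Delta>\<close> that a homomorphism fixes form a subfield of
  \<open>\<Delta>\<close>, and a prime field has only one. This is what makes the full automorphism group of \<open>P\<close> a Galois group over
  \<open>\<Delta>\<close>.\<close>

lemma (in field) hom_fixes_prime_field:
  assumes \<Delta>: "subfield \<Delta> R" "prime_field (R\<lparr>carrier := \<Delta>\<rparr>)"
    and P: "subfield P R" "\<Delta> \<subseteq> P" and \<phi>: "\<phi> \<in> ring_hom (R\<lparr>carrier := P\<rparr>) R" and "x \<in> \<Delta>"
  shows "\<phi> x = x"
proof -
  interpret h: ring_hom_ring "R\<lparr>carrier := P\<rparr>" R \<phi>
    by (rule subfield_hom_ring[OF P(1) \<phi>])
  define S where "S = {x \<in> \<Delta>. \<phi> x = x}"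
  note props = subringE[OF subfieldE(1)[OF \<Delta>(1)]]
  have ops: "\<phi> (a \<otimes> b) = \<phi> a \<otimes> \<phi> b" "\<phi> (a \<oplus> b) = \<phi> a \<oplus> \<phi> b" if "a \<in> \<Delta>" "b \<in> \<Delta>" for a b
    using that P(2) ring_hom_memE(2,3)[OF \<phi>, of a b] by auto
  have "subfield S R"
  proof (intro subfieldI' subringI)
    show "S \<subseteq> carrier R" using props(1) by (auto simp: S_def)
    show "\<one> \<in> S" using props(3) h.hom_one by (simp add: S_def)
    fix a assume a: "a \<in> S"
    then have a': "a \<in> \<Delta>" "\<phi> a = a" by (auto simp: S_def)
    have "\<phi> (\<ominus> a) = \<ominus> \<phi> a"
      using h.hom_a_inv[of a] a' P(2) subring_a_inv[OF subfieldE(1)[OF P(1)], of a] by auto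
    then show "\<ominus> a \<in> S" using a' props(5) by (simp add: S_def)
    fix b assume "b \<in> S"
    then have b': "b \<in> \<Delta>" "\<phi> b = b" by (auto simp: S_def)
    show "a \<otimes> b \<in> S" "a \<oplus> b \<in> S" using ops a' b' props(6,7) by (auto simp: S_def)
  next
    fix a assume "a \<in> S - {\<zero>}"
    then have a: "a \<in> \<Delta>" "\<phi> a = a" "a \<noteq> \<zero>" by (auto simp: S_def)
    note inv = subfield_m_inv[OF \<Delta>(1), of a]
    have aR: "a \<in> carrier R" using a(1) props(1) by blast
    have iR: "inv a \<in> carrier R" "inv a \<in> \<Delta>" using inv(1) a props(1) by auto
    have "a \<otimes> \<phi> (inv a) = \<one>"
      using ops(1)[of a "inv a"] inv a iR h.hom_one by auto
    moreover have "\<phi> (inv a) \<in> carrier R" using h.hom_closed iR P(2) by auto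
    ultimately have "\<phi> (inv a) = inv a"
      using comm_inv_char[of a "\<phi> (inv a)"] aR by simp
    then show "inv a \<in> S" using iR by (simp add: S_def)
  qed
  then have "S = carrier (R\<lparr>carrier := \<Delta>\<rparr>)"
    using prime_field_subfield_eq[OF \<Delta>(2), of S] subfield_subset_iff[OF \<Delta>(1), of S]
    by (auto simp: S_def)
  then show ?thesis using \<open>x \<in> \<Delta>\<close> by (auto simp: S_def)
qed


section \<open>Automorphism groups of normal extensions\<close>

lemma ring_aut_group_simps:
  "carrier (ring_aut_group R) = ring_hom R R \<inter> Bij (carrier R)"
  "\<one>\<^bsub>ring_aut_group R\<^esub> = (\<lambda>x \<in> carrier R. x)"
  by (simp_all add: ring_aut_group_def BijGroup_def)

lemma ring_aut_group_mult:
  assumes "\<phi> \<in> carrier (ring_aut_group R)" "\<psi> \<in> carrier (ring_aut_group R)"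
  shows "\<phi> \<otimes>\<^bsub>ring_aut_group R\<^esub> \<psi> = compose (carrier R) \<phi> \<psi>"
  using assms by (simp add: ring_aut_group_def BijGroup_def)

lemma (in ring) group_ring_aut_group: "group (ring_aut_group R)"
proof -
  have "subgroup (ring_hom R R \<inter> Bij (carrier R)) (BijGroup (carrier R))"
  proof
    show "ring_hom R R \<inter> Bij (carrier R) \<subseteq> carrier (BijGroup (carrier R))"
      by (auto simp: BijGroup_def)
    show "\<one>\<^bsub>BijGroup (carrier R)\<^esub> \<in> ring_hom R R \<inter> Bij (carrier R)"
      by (auto simp: BijGroup_def id_Bij ring_hom_def)
    fix f assume f: "f \<in> ring_hom R R \<inter> Bij (carrier R)"
    note hom = ring_hom_memE[of f R R]
    {
      fix g assume g: "g \<in> ring_hom R R \<inter> Bij (carrier R)"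
      then have "compose (carrier R) f g \<in> ring_hom R R"
        using f by (auto simp: ring_hom_def compose_def Pi_def)
      then show "f \<otimes>\<^bsub>BijGroup (carrier R)\<^esub> g \<in> ring_hom R R \<inter> Bij (carrier R)"
        using f g by (simp add: BijGroup_def compose_Bij)
    }
    define g where "g = (\<lambda>x \<in> carrier R. inv_into (carrier R) f x)"
    have bij: "bij_betw f (carrier R) (carrier R)" using f by (simp add: Bij_def)
    have inv: "g (f x) = x" if "x \<in> carrier R" for x
      using that bij by (auto simp: g_def bij_betw_def)
    have surj: "\<exists>y \<in> carrier R. x = f y" if "x \<in> carrier R" for x
      using that bij by (auto simp: bij_betw_def)
    have "g \<in> ring_hom R R"
    proof (rule ring_hom_memI)
      fix x assume "x \<in> carrier R"
      with surj obtain a where a: "a \<in> carrier R" "x = f a" by blast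
      show "g x \<in> carrier R" using a inv by simp
      fix y assume "y \<in> carrier R"
      with surj obtain b where b: "b \<in> carrier R" "y = f b" by blast
      have "f a \<otimes> f b = f (a \<otimes> b)" "f a \<oplus> f b = f (a \<oplus> b)"
        using f a b hom by auto
      then show "g (x \<otimes> y) = g x \<otimes> g y" "g (x \<oplus> y) = g x \<oplus> g y"
        using a b inv by simp_all
    next
      show "g \<one> = \<one>" using f hom(4) inv[of \<one>] by simp
    qed
    moreover have "g \<in> Bij (carrier R)" using f by (simp add: g_def restrict_inv_into_Bij)
    moreover have "inv\<^bsub>BijGroup (carrier R)\<^esub> f = g"
      using f by (simp add: inv_BijGroup g_def)
    ultimately show "inv\<^bsub>BijGroup (carrier R)\<^esub> f \<in> ring_hom R R \<inter> Bij (carrier R)" by simp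
  qed
  then show ?thesis
    unfolding ring_aut_group_def by (rule subgroup.subgroup_is_group[OF _ group_BijGroup])
qed

lemma field_Aut_carrier:
  assumes "\<phi> \<in> carrier (field_Aut A P)"
  shows "\<phi> \<in> ring_hom (A\<lparr>carrier := P\<rparr>) (A\<lparr>carrier := P\<rparr>)" "bij_betw \<phi> P P" "\<phi> \<in> extensional P"
  using assms by (auto simp: ring_aut_group_simps Bij_def)

lemma (in field) field_Aut_embedding:
  assumes "subfield P R" "\<phi> \<in> carrier (field_Aut R P)"
  shows "\<phi> \<in> ring_hom (R\<lparr>carrier := P\<rparr>) R"
  using field_Aut_carrier(1)[OF assms(2)] subfieldE(3)[OF assms(1)]
  by (auto simp: ring_hom_def Pi_def)

lemma (in field) embedding_restrict_field_Aut:
  assumes P: "subfield P R" and \<phi>: "\<phi> \<in> ring_hom (R\<lparr>carrier := P\<rparr>) R" "\<phi> ` P = P"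
  shows "restrict \<phi> P \<in> carrier (field_Aut R P)"
proof -
  note props = subringE[OF subfieldE(1)[OF P]]
  have "bij_betw (restrict \<phi> P) P P"
    using subfield_hom_inj[OF P \<phi>(1)] \<phi>(2) by (simp add: bij_betw_def inj_on_def)
  moreover have "restrict \<phi> P \<in> ring_hom (R\<lparr>carrier := P\<rparr>) (R\<lparr>carrier := P\<rparr>)"
    using \<phi> props by (auto simp: ring_hom_def Pi_def)
  ultimately show ?thesis by (simp add: ring_aut_group_simps Bij_def)
qed

lemma (in field) eval_zero_of_hom_fixing_coeffs:
  assumes P: "subfield P R" and \<phi>: "\<phi> \<in> ring_hom (R\<lparr>carrier := P\<rparr>) R"
    and p: "set p \<subseteq> P" "\<And>x. x \<in> set p \<Longrightarrow> \<phi> x = x" and z: "z \<in> P" "eval p z = \<zero>"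
  shows "eval p (\<phi> z) = \<zero>"
proof -
  interpret h: ring_hom_ring "R\<lparr>carrier := P\<rparr>" R \<phi>
    by (rule subfield_hom_ring[OF P \<phi>])
  have "\<phi> (eval p z) = eval (map \<phi> p) (\<phi> z)"
    using h.eval_hom'[of z p] p(1) z(1) by (simp add: eval_consistent[OF subfieldE(1)[OF P]])
  then show ?thesis using p(2) z(2) h.hom_zero by (simp add: map_idI)
qed

text \<open>The embedding sends every element to one of its
  conjugates, so normality keeps its values in \<open>P\<close>. It is onto because on the roots of a fixed minimal polynomial, a finite
  set, an injective map is surjective; this works even if \<open>P\<close> has infinite degree.\<close>

lemma (in algebraically_closed) normal_extension_embedding_image:
  assumes normal: "normal_extension L K P"
    and \<phi>: "\<phi> \<in> ring_hom (L\<lparr>carrier := P\<rparr>) L" "\<And>x. x \<in> K \<Longrightarrow> \<phi> x = x"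
  shows "\<phi> ` P = P"
proof -
  have K: "subfield K L" and P: "subfield P L" and KP: "K \<subseteq> P"
    and alg: "\<And>x. x \<in> P \<Longrightarrow> (algebraic over K) x"
    and conj: "\<And>x y. x \<in> P \<Longrightarrow> y \<in> carrier L \<Longrightarrow> eval (Irr K x) y = \<zero> \<Longrightarrow> y \<in> P"
    using normal by (auto simp: normal_extension_iff algebraic_extension_def field_extension_def)
  note subK = subfieldE(1)[OF K]
  have PL: "P \<subseteq> carrier L" by (rule subfieldE(3)[OF P])
  have mem: "\<phi> x \<in> carrier L" if "x \<in> P" for x
    using that ring_hom_memE(1)[OF \<phi>(1)] by simp
  have irr: "Irr K x \<in> carrier (K[X])" "eval (Irr K x) x = \<zero>" "Irr K x \<noteq> []" if x: "x \<in> P" for x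
  proof -
    have xL: "x \<in> carrier L" using x PL by blast
    note i = IrrE[OF K xL alg[OF x]]
    show "Irr K x \<in> carrier (K[X])" "eval (Irr K x) x = \<zero>" "Irr K x \<noteq> []"
      using i pirreducibleE(1)[OF subK i(1,2)] by auto
  qed
  have root: "eval (Irr K x) (\<phi> z) = \<zero>" if "x \<in> P" "z \<in> P" "eval (Irr K x) z = \<zero>" for x z
    using eval_zero_of_hom_fixing_coeffs[OF P \<phi>(1) _ _ that(2,3)]
      subfield_polynomial[OF K irr(1)[OF that(1)]]
      KP \<phi>(2) by blast
  have sub: "\<phi> x \<in> P" if "x \<in> P" for x
    using conj[OF that mem[OF that] root[OF that that irr(2)[OF that]]] .
  have "x \<in> \<phi> ` P" if x: "x \<in> P" for x
  proof -
    (* the conjugates of x, which the embedding permutes *)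
    define S where "S = {z \<in> P. eval (Irr K x) z = \<zero>}"
    have pL: "Irr K x \<in> carrier (poly_ring L)"
      using irr(1)[OF x] carrier_polynomial_shell[OF subK] by blast
    have "finite S"
      by (rule finite_subset[OF _ finite_number_of_roots[OF pL]])
        (use PL irr(3)[OF x] in \<open>auto simp: S_def is_root_def\<close>)
    moreover have "\<phi> ` S \<subseteq> S" using sub root[OF x] by (auto simp: S_def)
    moreover have "inj_on \<phi> S"
      using subfield_hom_inj[OF P \<phi>(1)] by (rule inj_on_subset) (auto simp: S_def)
    ultimately have "\<phi> ` S = S" by (rule endo_inj_surj)
    moreover have "x \<in> S" using x irr(2)[OF x] by (simp add: S_def)
    ultimately show ?thesis by (auto simp: S_def)
  qed
  then show ?thesis using sub by blast
qed

text \<open>The embedding of \<open>E\<close> extends to an embedding of \<open>P\<close> into the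
  algebraically closed field, and normality turns that into an automorphism of \<open>P\<close>.\<close>

lemma (in algebraically_closed) normal_extension_extend:
  assumes normal: "normal_extension L K P"
    and E: "subfield E L" "K \<subseteq> E" "E \<subseteq> P"
    and \<psi>: "\<psi> \<in> ring_hom (L\<lparr>carrier := E\<rparr>) L" "\<And>x. x \<in> K \<Longrightarrow> \<psi> x = x"
  obtains \<phi> where "\<phi> \<in> carrier (field_Aut L P)" "\<And>x. x \<in> E \<Longrightarrow> \<phi> x = \<psi> x"
proof -
  have P: "subfield P L" and alg: "\<And>x. x \<in> P \<Longrightarrow> (algebraic over K) x"
    using normal by (auto simp: normal_extension_def algebraic_extension_def field_extension_def)
  have "(algebraic over E) x" if "x \<in> P" for x
    using algebraic_mono[OF E(2)] alg[OF that] by blast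
  from extend_embedding[OF E(1) P E(3) this \<psi>(1)]
  obtain \<phi> where \<phi>: "\<phi> \<in> ring_hom (L\<lparr>carrier := P\<rparr>) L" "\<And>x. x \<in> E \<Longrightarrow> \<phi> x = \<psi> x" by blast
  then have "\<phi> ` P = P"
    using normal_extension_embedding_image[OF normal \<phi>(1)] E(2) \<psi>(2) by (metis subsetD)
  then have "restrict \<phi> P \<in> carrier (field_Aut L P)"
    using embedding_restrict_field_Aut[OF P \<phi>(1)] by blast
  then show thesis using that \<phi>(2) E(3) by (metis restrict_apply subsetD)
qed

text \<open>The Galois group acts transitively on conjugates: \<open>x \<mapsto> y\<close> defines
  an embedding of \<open>E(x)\<close> over \<open>E\<close>, which extends to an automorphism of \<open>P\<close>.\<close>

lemma (in algebraically_closed) conjugate_by_field_Aut: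
  assumes normal: "normal_extension L K P"
    and E: "subfield E L" "K \<subseteq> E" "E \<subseteq> P"
    and x: "x \<in> P" and y: "y \<in> carrier L" "eval (Irr E x) y = \<zero>"
  obtains \<phi> where "\<phi> \<in> galois_group L P E" "\<phi> x = y"
proof -
  have P: "subfield P L" and alg: "\<And>x. x \<in> P \<Longrightarrow> (algebraic over K) x"
    using normal by (auto simp: normal_extension_def algebraic_extension_def field_extension_def)
  have xL: "x \<in> carrier L" using x subfieldE(3)[OF P] by blast
  have xE: "(algebraic over E) x" using algebraic_mono[OF E(2)] alg[OF x] by blast
  have "set (Irr E x) \<subseteq> E" by (rule subfield_polynomial[OF E(1) IrrE(1)[OF E(1) xL xE]])
  have id: "(\<lambda>x. x) \<in> ring_hom (L\<lparr>carrier := E\<rparr>) L"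
    using subfieldE(3)[OF E(1)] by (auto simp: ring_hom_def)
  have "eval (map (\<lambda>x. x) (Irr E x)) y = \<zero>" using y by simp
  from hom_extend_simple[OF E(1) id xL xE y(1) this]
  obtain \<psi> where \<psi>: "\<psi> \<in> ring_hom (L\<lparr>carrier := simple_extension E x\<rparr>) L"
    "\<And>e. e \<in> E \<Longrightarrow> \<psi> e = e" "\<psi> x = y" by metis
  let ?E' = "simple_extension E x"
  have E': "subfield ?E' L" using simple_extension_is_subfield[OF E(1) xL] xE by blast
  have EE': "E \<subseteq> ?E'" using simple_extension_incl[OF subfieldE(3)[OF E(1)] xL] .
  have E'P: "?E' \<subseteq> P" using simple_extension_subring_incl[OF subfieldE(1)[OF P] E(3) x] .
  have "K \<subseteq> ?E'" "\<And>x. x \<in> K \<Longrightarrow> \<psi> x = x" using E(2) EE' \<psi>(2) by auto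
  from normal_extension_extend[OF normal E' this(1) E'P \<psi>(1) this(2)]
  obtain \<phi> where \<phi>: "\<phi> \<in> carrier (field_Aut L P)" "\<And>x. x \<in> ?E' \<Longrightarrow> \<phi> x = \<psi> x" by blast
  have "\<phi> x = y" using \<phi>(2)[OF simple_extension_mem[OF subfieldE(1)[OF E(1)] xL]] \<psi>(3) by simp
  moreover have "\<phi> \<in> galois_group L P E"
    using \<phi> \<psi>(2) EE' by (auto simp: galois_group_def)
  ultimately show thesis using that by blast
qed


section \<open>The Galois correspondence\<close>

text \<open>In a split polynomial the multiplicities of the roots add up to
  the degree, and divisibility bounds the multiplicities in \<open>p\<close> by those in \<open>q\<close>. So if \<open>p\<close> has
  at most one root, and \<open>q\<close> has only simple roots, then the degree of \<open>p\<close> is at most 1: it has at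
  most two coefficients.\<close>

lemma (in field) linear_of_separable_unique_root:
  assumes p: "p \<in> carrier (poly_ring R)" "p \<noteq> []" "splitted p"
    and q: "q \<in> carrier (poly_ring R)" "q \<noteq> []" "p pdivides q"
    and sep: "\<And>a. a \<in> carrier R \<Longrightarrow> alg_mult q a \<le> 1"
    and unique: "\<And>y. y \<in> carrier R \<Longrightarrow> eval p y = \<zero> \<Longrightarrow> y = x"
  shows "length p \<le> 2"
proof -
  have "count (roots p) a \<le> 1" for a
  proof (cases "a \<in> carrier R")
    case True
    have "count (roots p) a \<le> count (roots q) a"
      using pdivides_imp_roots_incl[OF p(1) q(1,2,3)] by (rule mset_subset_eq_count)
    then show ?thesis using sep[OF True] alg_mult_eq_count_roots[OF q(1)] by simp
  next
    case False
    then show ?thesis by (simp add: alg_mult_def flip: alg_mult_eq_count_roots[OF p(1)])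
  qed
  moreover have "set_mset (roots p) \<subseteq> {x}"
    using unique by (auto simp: roots_mem_iff_is_root[OF p(1)] is_root_def)
  ultimately have "size (roots p) \<le> 1"
    by (metis (no_types, lifting) count_le_replicate_mset_subset_eq count_replicate_mset dual_order.trans
        size_mset_mono size_replicate_mset set_mset_subset_singletonD)
  then show ?thesis using p(3) unfolding splitted_def by linarith
qed

text \<open>The minimal polynomial of \<open>x\<close> over \<open>F\<close> is not linear, as
  \<open>x \<notin> F\<close>, and it divides the minimal polynomial over \<open>K\<close>, which has simple roots. So \<open>x\<close> has a
  conjugate \<open>y \<noteq> x\<close> over \<open>F\<close>, and some automorphism over \<open>F\<close> maps \<open>x\<close> to \<open>y\<close>.\<close>

lemma (in algebraically_closed) exists_galois_group_moving:
  assumes gal: "galois_extension L K P" and F: "subfield F L" "K \<subseteq> F" "F \<subseteq> P"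
    and x: "x \<in> P" "x \<notin> F"
  obtains \<phi> where "\<phi> \<in> galois_group L P F" "\<phi> x \<noteq> x"
proof -
  have normal: "normal_extension L K P" and K: "subfield K L" and P: "subfield P L"
    and alg: "\<And>x. x \<in> P \<Longrightarrow> (algebraic over K) x"
    and sep: "\<And>a. a \<in> carrier L \<Longrightarrow> alg_mult (Irr K x) a \<le> 1"
    using gal x(1) by (auto simp: galois_extension_def separable_extension_def
        algebraic_extension_def field_extension_def)
  have xL: "x \<in> carrier L" using x subfieldE(3)[OF P] by blast
  have xF: "(algebraic over F) x" using algebraic_mono[OF F(2)] alg[OF x(1)] by blast
  note p = IrrE[OF F(1) xL xF]
  note q = IrrE[OF K xL alg[OF x(1)]]
  have pL: "Irr F x \<in> carrier (poly_ring L)"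
    using p(1) carrier_polynomial_shell[OF subfieldE(1)[OF F(1)]] by blast
  have qL: "Irr K x \<in> carrier (poly_ring L)"
    using q(1) carrier_polynomial_shell[OF subfieldE(1)[OF K]] by blast
  have "Irr K x \<in> carrier (F[X])"
    using q(1) F(2) by (auto simp: polynomial_def simp flip: univ_poly_carrier)
  then have div: "Irr F x pdivides Irr K x" using Irr_minimal[OF F(1) xL xF] q(4) by blast
  have nonzero: "Irr F x \<noteq> []" "Irr K x \<noteq> []"
    using pirreducibleE(1)[OF subfieldE(1)[OF F(1)] p(1,2)]
      pirreducibleE(1)[OF subfieldE(1)[OF K] q(1,2)] by blast+
  have "\<exists>y \<in> carrier L. eval (Irr F x) y = \<zero> \<and> y \<noteq> x"
  proof (rule ccontr)
    assume "\<not> ?thesis"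
    then have "length (Irr F x) \<le> 2"
      using linear_of_separable_unique_root[OF pL nonzero(1) roots_over_carrier[OF pL] qL
          nonzero(2) div sep] by blast
    moreover have "length (Irr F x) - 1 \<ge> 1" using pirreducible_degree[OF F(1) p(1,2)] .
    ultimately have "length (Irr F x) = 2" by linarith
    then obtain a b where ab: "Irr F x = [a, b]"
      by (auto simp: numeral_2_eq_2 length_Suc_conv)
    then have "a = \<one>" "b \<in> F"
      using p(3) subfield_polynomial[OF F(1) p(1)] by auto
    moreover from this have bL: "b \<in> carrier L" using subfieldE(3)[OF F(1)] by blast
    ultimately have "x \<oplus> b = \<zero>" using p(4) ab xL by simp
    then have "x = \<ominus> b" using xL bL by (simp add: minus_equality)
    then show False using x(2) \<open>b \<in> F\<close> subringE(5)[OF subfieldE(1)[OF F(1)]] by blast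
  qed
  then obtain y where y: "y \<in> carrier L" "eval (Irr F x) y = \<zero>" "y \<noteq> x" by blast
  from conjugate_by_field_Aut[OF normal F x(1) y(1,2)] show thesis using that y(3) by metis
qed

lemma (in algebraically_closed) fixed_field_galois_group:
  assumes "galois_extension L K P" "subfield F L" "K \<subseteq> F" "F \<subseteq> P"
  shows "fixed_field P (galois_group L P F) = F"
proof
  show "F \<subseteq> fixed_field P (galois_group L P F)"
    using assms(4) by (auto simp: fixed_field_def galois_group_def)
  show "fixed_field P (galois_group L P F) \<subseteq> F"
    using exists_galois_group_moving[OF assms] unfolding fixed_field_def by blast
qed

lemma galois_extension_subset:
  assumes "galois_extension A K P" "subfield F A" "K \<subseteq> F" "F \<subseteq> P" "normal_extension A K F"
  shows "galois_extension A K F"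
  using assms
  by (auto simp: galois_extension_def separable_extension_def normal_extension_def)

text \<open>If \<open>y = \<phi> x\<close> is a conjugate over \<open>K\<close> of \<open>x \<in> F\<close> and
  \<open>\<eta>\<close> fixes \<open>F\<close>, then so does \<open>\<phi>\<^sup>-\<^sup>1 \<eta> \<phi>\<close>, by normality of the subgroup; applied to \<open>x\<close> this says
  \<open>\<eta> y = y\<close>. So all conjugates of \<open>x\<close> lie in the fixed field, which is \<open>F\<close>.\<close>

lemma (in algebraically_closed) galois_of_normal_galois_group:
  assumes gal: "galois_extension L K P" and F: "subfield F L" "K \<subseteq> F" "F \<subseteq> P"
    and normal_subgroup: "galois_group L P F \<lhd> field_Aut L P"
  shows "galois_extension L K F"
proof (rule galois_extension_subset[OF gal F])
  have normal: "normal_extension L K P" and K: "subfield K L" and P: "subfield P L"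
    and alg: "\<And>x. x \<in> P \<Longrightarrow> (algebraic over K) x"
    and conj: "\<And>x y. x \<in> P \<Longrightarrow> y \<in> carrier L \<Longrightarrow> eval (Irr K x) y = \<zero> \<Longrightarrow> y \<in> P"
    using gal by (auto simp: galois_extension_def normal_extension_iff
        algebraic_extension_def field_extension_def)
  interpret P: field "L\<lparr>carrier := P\<rparr>" by (rule subfield_iff(2)[OF P])
  interpret G: group "field_Aut L P" by (rule P.group_ring_aut_group)
  interpret H: normal "galois_group L P F" "field_Aut L P" by (rule normal_subgroup)
  have "y \<in> F" if x: "x \<in> F" and y: "y \<in> carrier L" "eval (Irr K x) y = \<zero>" for x y
  proof -
    have xP: "x \<in> P" using x F(3) by blast
    have "K \<subseteq> P" using F(2,3) by blast
    from conjugate_by_field_Aut[OF normal K subset_refl this xP y]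
    obtain \<phi> where \<phi>: "\<phi> \<in> galois_group L P K" "\<phi> x = y" .
    have \<phi>G: "\<phi> \<in> carrier (field_Aut L P)" using \<phi>(1) unfolding galois_group_def by blast
    have "\<eta> y = y" if \<eta>: "\<eta> \<in> galois_group L P F" for \<eta>
    proof -
      have \<eta>G: "\<eta> \<in> carrier (field_Aut L P)" using \<eta> unfolding galois_group_def by blast
      (* \<theta> is the conjugate of \<eta> by \<phi>; it fixes x because it lies in the normal subgroup *)
      define \<theta> where "\<theta> = inv\<^bsub>field_Aut L P\<^esub> \<phi> \<otimes>\<^bsub>field_Aut L P\<^esub> \<eta> \<otimes>\<^bsub>field_Aut L P\<^esub> \<phi>"
      have "\<theta> \<in> galois_group L P F"
        unfolding \<theta>_def by (rule H.inv_op_closed1[OF \<phi>G \<eta>])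
      then have \<theta>: "\<theta> \<in> carrier (field_Aut L P)" "\<theta> x = x"
        using x unfolding galois_group_def by blast+
      have "\<phi> \<otimes>\<^bsub>field_Aut L P\<^esub> \<theta> = \<eta> \<otimes>\<^bsub>field_Aut L P\<^esub> \<phi>"
        using \<phi>G \<eta>G by (simp add: \<theta>_def flip: G.m_assoc)
      then have "compose P \<phi> \<theta> x = compose P \<eta> \<phi> x"
        using ring_aut_group_mult[OF \<phi>G \<theta>(1)] ring_aut_group_mult[OF \<eta>G \<phi>G] by simp
      then show ?thesis using xP \<theta>(2) \<phi>(2) by (simp add: compose_def)
    qed
    then have "y \<in> fixed_field P (galois_group L P F)"
      using conj[OF xP y] by (simp add: fixed_field_def)
    then show "y \<in> F" using fixed_field_galois_group[OF gal F] by simp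
  qed
  then show "normal_extension L K F"
    using K F alg by (auto simp: normal_extension_iff algebraic_extension_def field_extension_def)
qed

text \<open>Automorphisms of \<open>P\<close> fix the prime field \<open>K\<close>, hence map the
  normal extension \<open>F\<close> onto itself; conversely automorphisms of \<open>F\<close> extend to \<open>P\<close>. So restriction
  presents the automorphism group of \<open>F\<close> as the quotient by \<open>G(P/F)\<close>.\<close>

lemma (in algebraically_closed) restriction_group_hom:
  assumes prime: "prime_field (L\<lparr>carrier := K\<rparr>)"
    and gal: "galois_extension L K P" and F: "galois_extension L K F" "F \<subseteq> P"
  shows "group_hom (field_Aut L P) (field_Aut L F) (\<lambda>\<phi>. restrict \<phi> F)"
    and "kernel (field_Aut L P) (field_Aut L F) (\<lambda>\<phi>. restrict \<phi> F) = galois_group L P F"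
    and "(\<lambda>\<phi>. restrict \<phi> F) ` carrier (field_Aut L P) = carrier (field_Aut L F)"
proof -
  have normal: "normal_extension L K P" "normal_extension L K F"
    and K: "subfield K L" "K \<subseteq> F" "K \<subseteq> P" and P: "subfield P L" and FL: "subfield F L"
    using gal F(1) by (auto simp: galois_extension_def algebraic_extension_def field_extension_def)
  interpret P: field "L\<lparr>carrier := P\<rparr>" by (rule subfield_iff(2)[OF P])
  interpret F: field "L\<lparr>carrier := F\<rparr>" by (rule subfield_iff(2)[OF FL])
  have im: "\<phi> ` F = F" "restrict \<phi> F \<in> carrier (field_Aut L F)"
    if \<phi>: "\<phi> \<in> carrier (field_Aut L P)" for \<phi>
  proof -
    have hom: "\<phi> \<in> ring_hom (L\<lparr>carrier := P\<rparr>) L" by (rule field_Aut_embedding[OF P \<phi>])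
    then have homF: "\<phi> \<in> ring_hom (L\<lparr>carrier := F\<rparr>) L"
      using F(2) by (auto simp: ring_hom_def Pi_def subset_iff)
    from hom_fixes_prime_field[OF K(1) prime FL K(2) homF] show im: "\<phi> ` F = F"
      by (rule normal_extension_embedding_image[OF normal(2) homF])
    show "restrict \<phi> F \<in> carrier (field_Aut L F)"
      by (rule embedding_restrict_field_Aut[OF FL homF im])
  qed
  have "restrict (\<phi> \<otimes>\<^bsub>field_Aut L P\<^esub> \<psi>) F = restrict \<phi> F \<otimes>\<^bsub>field_Aut L F\<^esub> restrict \<psi> F"
    if \<phi>: "\<phi> \<in> carrier (field_Aut L P)" "\<psi> \<in> carrier (field_Aut L P)" for \<phi> \<psi>
    using ring_aut_group_mult[OF \<phi>] ring_aut_group_mult[OF im(2)[OF \<phi>(1)] im(2)[OF \<phi>(2)]]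
      im(1)[OF \<phi>(2)] F(2) by (auto simp: compose_def restrict_def fun_eq_iff)
  then show "group_hom (field_Aut L P) (field_Aut L F) (\<lambda>\<phi>. restrict \<phi> F)"
    using im(2) P.group_ring_aut_group F.group_ring_aut_group
    by (auto simp: group_hom_def group_hom_axioms_def hom_def)
  show "kernel (field_Aut L P) (field_Aut L F) (\<lambda>\<phi>. restrict \<phi> F) = galois_group L P F"
    by (auto simp: kernel_def galois_group_def ring_aut_group_simps(2) restrict_def fun_eq_iff)
  have "\<psi> \<in> (\<lambda>\<phi>. restrict \<phi> F) ` carrier (field_Aut L P)"
    if \<psi>: "\<psi> \<in> carrier (field_Aut L F)" for \<psi>
  proof -
    have hom: "\<psi> \<in> ring_hom (L\<lparr>carrier := F\<rparr>) L" by (rule field_Aut_embedding[OF FL \<psi>])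
    from normal_extension_extend[OF normal(1) FL K(2) F(2) hom
        hom_fixes_prime_field[OF K(1) prime FL K(2) hom]]
    obtain \<phi> where \<phi>: "\<phi> \<in> carrier (field_Aut L P)" "\<And>x. x \<in> F \<Longrightarrow> \<phi> x = \<psi> x" by blast
    have "restrict \<phi> F = restrict \<psi> F" using \<phi>(2) by (auto simp: restrict_def)
    also have "\<dots> = \<psi>" using field_Aut_carrier(3)[OF \<psi>] by (rule extensional_restrict)
    finally show ?thesis using \<phi>(1) by blast
  qed
  then show "(\<lambda>\<phi>. restrict \<phi> F) ` carrier (field_Aut L P) = carrier (field_Aut L F)"
    using im(2) by auto
qed

text \<open>The first isomorphism theorem, read from the image to the quotient
  and with the value of the isomorphism made explicit.\<close>

lemma (in group_hom) factor_iso_of_surj: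
  assumes "h ` carrier G = carrier H"
  shows "\<exists>\<theta> \<in> iso H (G Mod kernel G H h). \<forall>g \<in> carrier G. \<theta> (h g) = kernel G H h #> g"
proof -
  let ?N = "kernel G H h"
  let ?f = "\<lambda>C. the_elem (h ` C)"
  have f: "?f \<in> iso (G Mod ?N) H" by (rule FactGroup_iso_set[OF assms])
  interpret N: normal ?N G by (rule normal_kernel)
  interpret Q: group "G Mod ?N" by (rule N.factorgroup_is_group)
  have inj: "inj_on ?f (carrier (G Mod ?N))" by (rule FactGroup_inj_on)
  show ?thesis
  proof (intro bexI ballI)
    show "inv_into (carrier (G Mod ?N)) ?f \<in> iso H (G Mod ?N)" by (rule Q.iso_set_sym[OF f])
    fix g assume g: "g \<in> carrier G"
    have mem: "?N #> g \<in> carrier (G Mod ?N)" using g by (auto simp: FactGroup_def RCOSETS_def)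
    have "h y = h g" if y: "y \<in> ?N #> g" for y
    proof -
      obtain x where x: "x \<in> carrier G" "h x = \<one>\<^bsub>H\<^esub>" "y = x \<otimes> g"
        using y unfolding r_coset_def kernel_def by blast
      show ?thesis unfolding x(3) using hom_mult[OF x(1) g] x(2) g by (metis H.l_one hom_closed)
    qed
    moreover have "g \<in> ?N #> g" by (rule G.rcos_self[OF g subgroup_kernel])
    ultimately have "h ` (?N #> g) = {h g}" by blast
    then have "?f (?N #> g) = h g" by simp
    then show "inv_into (carrier (G Mod ?N)) ?f (h g) = ?N #> g"
      using inv_into_f_f[OF inj mem] by simp
  qed
qed


section \<open>Paige loops determine their fields\<close>

definition cd_pm_one :: "('a, 'b) ring_scheme \<Rightarrow> 'a cd_mat set" where
  "cd_pm_one R = {\<one>\<^bsub>cayley_dickson R\<^esub>, (\<ominus>\<^bsub>R\<^esub> \<one>\<^bsub>R\<^esub>) \<odot>\<^bsub>cayley_dickson R\<^esub> \<one>\<^bsub>cayley_dickson R\<^esub>}"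

lemma paige_loop_simps:
  "carrier (paige_loop R) =
     (\<lambda>a. (\<lambda>h. cd_mult R h a) ` cd_pm_one R) ` {a \<in> cd_carrier R. cd_norm R a = \<one>\<^bsub>R\<^esub>}"
  "\<one>\<^bsub>paige_loop R\<^esub> = cd_pm_one R"
  "C \<otimes>\<^bsub>paige_loop R\<^esub> D = (\<Union>h \<in> C. \<Union>k \<in> D. {cd_mult R h k})"
  by (auto simp: paige_loop_def FactGroup_def RCOSETS_def r_coset_def set_mult_def
      unit_norm_loop_def cayley_dickson_def cd_pm_one_def)

lemma (in ring) cd_mult_closed:
  assumes "a \<in> cd_carrier R" "b \<in> cd_carrier R"
  shows "cd_mult R a b \<in> cd_carrier R"
  using assms
  by (auto simp: cd_carrier_def Let_def scalar_prod3_def vector_prod3_def add3_def diff3_def smult3_def)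

lemma (in ring) cd_pm_one_closed: "cd_pm_one R \<subseteq> cd_carrier R"
  by (auto simp: cd_pm_one_def cayley_dickson_def cd_carrier_def Let_def zero3_def smult3_def)

lemma (in ring) subring_a_minus:
  assumes "subring F R" "b \<in> F"
  shows "a \<ominus>\<^bsub>R\<lparr>carrier := F\<rparr>\<^esub> b = a \<ominus> b"
  using subring_a_inv[OF assms] by (simp add: a_minus_def)

lemma cd_carrierE:
  assumes "a \<in> cd_carrier R"
  obtains a1 u1 u2 u3 v1 v2 v3 a2 where "a = CD_Mat a1 (u1, u2, u3) (v1, v2, v3) a2"
    "a1 \<in> carrier R" "u1 \<in> carrier R" "u2 \<in> carrier R" "u3 \<in> carrier R"
    "v1 \<in> carrier R" "v2 \<in> carrier R" "v3 \<in> carrier R" "a2 \<in> carrier R"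
  using assms by (auto simp: cd_carrier_def Let_def)

text \<open>Of the operations used in the product, only subtraction refers to the
  carrier, because negatives are defined as inverses within it; on elements of a subring they
  agree with those of the whole ring.\<close>

lemma (in ring) cd_mult_subring:
  assumes F: "subring F R" and a: "a \<in> cd_carrier (R\<lparr>carrier := F\<rparr>)" and b: "b \<in> cd_carrier (R\<lparr>carrier := F\<rparr>)"
  shows "cd_mult (R\<lparr>carrier := F\<rparr>) a b = cd_mult R a b"
proof -
  note [simp] = subringE(6,7)[OF F] subring_a_minus[OF F]
  have [simp]: "x \<ominus> y \<in> F" if "x \<in> F" "y \<in> F" for x y
    using that subringE(5,7)[OF F] by (simp add: a_minus_def)
  show ?thesis
    by (rule cd_carrierE[OF a], rule cd_carrierE[OF b])
      (simp add: scalar_prod3_def vector_prod3_def add3_def diff3_def smult3_def)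
qed

lemma (in ring) cd_norm_subring:
  assumes F: "subring F R" and a: "a \<in> cd_carrier (R\<lparr>carrier := F\<rparr>)"
  shows "cd_norm (R\<lparr>carrier := F\<rparr>) a = cd_norm R a"
  by (rule cd_carrierE[OF a])
    (simp add: scalar_prod3_def subring_a_minus[OF F] subringE(6,7)[OF F])

lemma (in ring) cd_pm_one_subring:
  assumes F: "subring F R"
  shows "cd_pm_one (R\<lparr>carrier := F\<rparr>) = cd_pm_one R"
  by (simp add: cd_pm_one_def cayley_dickson_def zero3_def smult3_def subring_a_inv[OF F subringE(3)[OF F]])

lemma (in ring) paige_loop_elements:
  assumes "C \<in> carrier (paige_loop R)"
  shows "C \<subseteq> cd_carrier R"
  using assms cd_mult_closed cd_pm_one_closed by (auto simp: paige_loop_simps)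

lemma (in ring) paige_loop_subring:
  assumes F: "subring F R"
  shows "subloop_of (paige_loop (R\<lparr>carrier := F\<rparr>)) (paige_loop R)"
proof -
  interpret F: ring "R\<lparr>carrier := F\<rparr>" by (rule subring_is_ring[OF F])
  note pm = cd_pm_one_subring[OF F]
  have sub: "cd_carrier (R\<lparr>carrier := F\<rparr>) \<subseteq> cd_carrier R"
    using subringE(1)[OF F] by (auto simp: cd_carrier_def Let_def)
  have "carrier (paige_loop (R\<lparr>carrier := F\<rparr>)) \<subseteq> carrier (paige_loop R)"
  proof
    fix C assume "C \<in> carrier (paige_loop (R\<lparr>carrier := F\<rparr>))"
    then obtain a where a: "a \<in> cd_carrier (R\<lparr>carrier := F\<rparr>)" "cd_norm (R\<lparr>carrier := F\<rparr>) a = \<one>"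
      and C: "C = (\<lambda>h. cd_mult (R\<lparr>carrier := F\<rparr>) h a) ` cd_pm_one (R\<lparr>carrier := F\<rparr>)"
      by (auto simp: paige_loop_simps)
    have "C = (\<lambda>h. cd_mult R h a) ` cd_pm_one R"
      unfolding C pm
      by (rule image_cong[OF refl]) (use cd_mult_subring[OF F _ a(1)] F.cd_pm_one_closed pm in blast)
    then show "C \<in> carrier (paige_loop R)"
      using a sub cd_norm_subring[OF F a(1)] by (auto simp: paige_loop_simps)
  qed
  moreover have "C \<otimes>\<^bsub>paige_loop (R\<lparr>carrier := F\<rparr>)\<^esub> D = C \<otimes>\<^bsub>paige_loop R\<^esub> D"
    if "C \<in> carrier (paige_loop (R\<lparr>carrier := F\<rparr>))" "D \<in> carrier (paige_loop (R\<lparr>carrier := F\<rparr>))" for C D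
    using F.paige_loop_elements[OF that(1)] F.paige_loop_elements[OF that(2)]
      cd_mult_subring[OF F] unfolding paige_loop_simps(3) by (intro SUP_cong refl) blast
  ultimately show ?thesis
    unfolding subloop_of_def paige_loop_simps(2) pm by blast
qed

text \<open>The matrix with diagonal \<open>1, 1\<close>, with \<open>(x, 0, 0)\<close> in the upper
  right corner and \<open>0\<close> elsewhere, has norm 1 for every \<open>x\<close>. Thus every ring element occurs as an
  entry of a matrix in some coset that belongs to the Paige loop.\<close>

lemma (in ring) exists_paige_loop_element:
  assumes "x \<in> carrier R"
  shows "\<exists>C \<in> carrier (paige_loop R). \<exists>a u v c d. CD_Mat a (x, u, v) c d \<in> C"
proof -
  define z where "z = CD_Mat \<one> (x, \<zero>, \<zero>) (zero3 R) \<one>"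
  have "z \<in> cd_carrier R" "cd_norm R z = \<one>"
    using assms by (auto simp: z_def cd_carrier_def Let_def zero3_def scalar_prod3_def a_minus_def)
  then have C: "(\<lambda>h. cd_mult R h z) ` cd_pm_one R \<in> carrier (paige_loop R)"
    by (auto simp: paige_loop_simps)
  have "cd_mult R \<one>\<^bsub>cayley_dickson R\<^esub> z = z"
    using assms unfolding z_def
    by (simp add: cayley_dickson_def zero3_def smult3_def add3_def diff3_def
        scalar_prod3_def vector_prod3_def a_minus_def)
  then have "z \<in> (\<lambda>h. cd_mult R h z) ` cd_pm_one R"
    unfolding cd_pm_one_def by (metis image_eqI insertI1)
  then have "\<exists>a u v c d. CD_Mat a (x, u, v) c d \<in> (\<lambda>h. cd_mult R h z) ` cd_pm_one R"
    unfolding z_def by blast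
  then show ?thesis using C by (rule bexI)
qed

text \<open>An inclusion of the loops, which are sets of cosets, forces an
  inclusion of the sets of matrix entries that occur in them.\<close>

lemma (in field) subloop_of_Paige_iff:
  assumes F: "subfield F R" and F': "subfield F' R"
  shows "subloop_of (Paige R F) (Paige R F') \<longleftrightarrow> F \<subseteq> F'"
proof
  interpret F: ring "R\<lparr>carrier := F\<rparr>" by (rule subring_is_ring[OF subfieldE(1)[OF F]])
  interpret F': ring "R\<lparr>carrier := F'\<rparr>" by (rule subring_is_ring[OF subfieldE(1)[OF F']])
  {
    assume sub: "subloop_of (Paige R F) (Paige R F')"
    show "F \<subseteq> F'"
    proof
      fix x assume "x \<in> F"
      then obtain C a u v c d where "C \<in> carrier (Paige R F)" "CD_Mat a (x, u, v) c d \<in> C"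
        using F.exists_paige_loop_element[of x] by auto
      then have "CD_Mat a (x, u, v) c d \<in> cd_carrier (R\<lparr>carrier := F'\<rparr>)"
        using sub F'.paige_loop_elements unfolding subloop_of_def by blast
      then show "x \<in> F'" by (auto simp: cd_carrier_def)
    qed
  next
    assume "F \<subseteq> F'"
    then have "subring F (R\<lparr>carrier := F'\<rparr>)"
      using F'.subring_iff[of F] F.ring_axioms by simp
    from F'.paige_loop_subring[OF this] show "subloop_of (Paige R F) (Paige R F')" by simp
  }
qed

lemma subloop_of_refl: "subloop_of M M"
  by (simp add: subloop_of_def)

lemma (in field) Paige_eq_iff:
  assumes "subfield F R" "subfield F' R"
  shows "Paige R F = Paige R F' \<longleftrightarrow> F = F'"
  using subloop_of_Paige_iff[OF assms] subloop_of_Paige_iff[OF assms(2,1)] subloop_of_refl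
  by (metis subset_antisym)


section \<open>The correspondence between Paige loops and normal subgroups\<close>

theorem theorem3:
  fixes A :: "('a, 'b) ring_scheme" and \<Delta> P :: "'a set"
  assumes closure: "algebraic_closure A \<Delta>"
    and prime: "prime_field (A\<lparr>carrier := \<Delta>\<rparr>)"
    and galois: "galois_extension A \<Delta> P"
  shows "\<exists>\<Phi>.
    bij_betw \<Phi> (Sigma_loops A \<Delta> P) (Sigma_groups A \<Delta> P) \<and>
    (\<forall>F \<in> Sigma_fields A \<Delta> P. \<forall>H \<in> Sigma_groups A \<Delta> P.
       \<Phi> (Paige A F) = H \<longleftrightarrow> F = fixed_field P H) \<and>
    (\<forall>F \<in> Sigma_fields A \<Delta> P.
       galois_group A P F \<in> Sigma_groups A \<Delta> P \<and>
       \<Phi> (Paige A F) = galois_group A P F \<and>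
       (\<exists>\<theta> \<in> iso (field_Aut A F) (field_Aut A P Mod galois_group A P F).
          \<forall>\<phi> \<in> carrier (field_Aut A P).
            restrict \<phi> F \<in> carrier (field_Aut A F) \<and>
            \<theta> (restrict \<phi> F) = galois_group A P F #>\<^bsub>field_Aut A P\<^esub> \<phi>)) \<and>
    (\<forall>F \<in> Sigma_fields A \<Delta> P.
       F = fixed_field P (galois_group A P F) \<and>
       (\<forall>F' \<in> Sigma_fields A \<Delta> P. galois_group A P F' = galois_group A P F \<longrightarrow> F' = F)) \<and>
    (\<forall>H \<in> Sigma_groups A \<Delta> P.
       \<exists>F \<in> Sigma_fields A \<Delta> P. H = galois_group A P F \<and> F = fixed_field P H) \<and>
    (\<forall>F \<in> Sigma_fields A \<Delta> P. \<forall>F' \<in> Sigma_fields A \<Delta> P.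
       let H = galois_group A P F; H' = galois_group A P F' in
       (subloop_of (Paige A F) (Paige A F') \<longleftrightarrow> H \<supseteq> H') \<and>
       (proper_subloop_of (Paige A F) (Paige A F') \<longleftrightarrow> H \<supset> H') \<and>
       (Paige A F \<noteq> Paige A F' \<longleftrightarrow> H \<noteq> H') \<and>
       (subloop_of (Paige A F') (Paige A F) \<longleftrightarrow> H \<subseteq> H') \<and>
       (proper_subloop_of (Paige A F') (Paige A F) \<longleftrightarrow> H \<subset> H'))"
proof -
  interpret algebraic_closure A \<Delta> by (rule closure)
  let ?\<Sigma> = "Sigma_fields A \<Delta> P" and ?\<Gamma> = "Sigma_groups A \<Delta> P"
  let ?G = "galois_group A P"
  have \<Sigma>: "galois_extension A \<Delta> F" "subfield F A" "\<Delta> \<subseteq> F" "F \<subseteq> P" if "F \<in> ?\<Sigma>" for F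
    using that by (auto simp: Sigma_fields_def galois_extension_def algebraic_extension_def
        field_extension_def)
  have fixed: "fixed_field P (?G F) = F" if "F \<in> ?\<Sigma>" for F
    by (rule fixed_field_galois_group[OF galois \<Sigma>(2-4)[OF that]])
  have restriction: "group_hom (field_Aut A P) (field_Aut A F) (\<lambda>\<phi>. restrict \<phi> F)"
    "kernel (field_Aut A P) (field_Aut A F) (\<lambda>\<phi>. restrict \<phi> F) = ?G F"
    "(\<lambda>\<phi>. restrict \<phi> F) ` carrier (field_Aut A P) = carrier (field_Aut A F)" if "F \<in> ?\<Sigma>" for F
    using restriction_group_hom[OF prime galois \<Sigma>(1,4)[OF that]] by blast+
  have group: "?G F \<in> ?\<Gamma>" if F: "F \<in> ?\<Sigma>" for F
    using group_hom.normal_kernel[OF restriction(1)[OF F]] \<Sigma>(2-4)[OF F]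
    unfolding Sigma_groups_def restriction(2)[OF F] by blast
  have field: "\<exists>F \<in> ?\<Sigma>. H = ?G F \<and> F = fixed_field P H" if mem: "H \<in> ?\<Gamma>" for H
  proof -
    obtain F where H: "H \<lhd> field_Aut A P" "H = ?G F"
      and F: "subfield F A" "\<Delta> \<subseteq> F" "F \<subseteq> P"
      using mem unfolding Sigma_groups_def by blast
    have "F \<in> ?\<Sigma>"
      using galois_of_normal_galois_group[OF galois F H(1)[unfolded H(2)]] F(3)
      unfolding Sigma_fields_def by blast
    then show ?thesis using H(2) fixed by blast
  qed
  have anti: "?G F' \<subseteq> ?G F \<longleftrightarrow> F \<subseteq> F'" if "F \<in> ?\<Sigma>" "F' \<in> ?\<Sigma>" for F F'
  proof
    assume "?G F' \<subseteq> ?G F"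
    then have "fixed_field P (?G F) \<subseteq> fixed_field P (?G F')"
      unfolding fixed_field_def by blast
    then show "F \<subseteq> F'" using fixed[OF that(1)] fixed[OF that(2)] by simp
  qed (auto simp: galois_group_def)
  have inj: "?G F = ?G F' \<longleftrightarrow> F = F'" if "F \<in> ?\<Sigma>" "F' \<in> ?\<Sigma>" for F F'
    using fixed[OF that(1)] fixed[OF that(2)] by metis
  have loop_eq: "Paige A F = Paige A F' \<longleftrightarrow> F = F'" if "F \<in> ?\<Sigma>" "F' \<in> ?\<Sigma>" for F F'
    by (rule Paige_eq_iff[OF \<Sigma>(2)[OF that(1)] \<Sigma>(2)[OF that(2)]])
  have loop_sub: "subloop_of (Paige A F) (Paige A F') \<longleftrightarrow> F \<subseteq> F'" if "F \<in> ?\<Sigma>" "F' \<in> ?\<Sigma>" for F F'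
    by (rule subloop_of_Paige_iff[OF \<Sigma>(2)[OF that(1)] \<Sigma>(2)[OF that(2)]])
  define \<Phi> where "\<Phi> M = ?G (inv_into ?\<Sigma> (Paige A) M)" for M
  have "inj_on (Paige A) ?\<Sigma>" using loop_eq by (auto intro: inj_onI)
  then have \<Phi>: "\<Phi> (Paige A F) = ?G F" if "F \<in> ?\<Sigma>" for F
    unfolding \<Phi>_def using inv_into_f_f[OF _ that, of "Paige A"] by metis
  show ?thesis
  proof (intro exI[of _ \<Phi>] conjI)
    show "bij_betw \<Phi> (Sigma_loops A \<Delta> P) ?\<Gamma>"
      unfolding bij_betw_def
    proof
      show "inj_on \<Phi> (Sigma_loops A \<Delta> P)"
        unfolding Sigma_loops_def using \<Phi> inj by (auto intro!: inj_onI)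
      show "\<Phi> ` Sigma_loops A \<Delta> P = ?\<Gamma>"
        unfolding Sigma_loops_def image_image using \<Phi> group field by force
    qed
    show "\<forall>F \<in> ?\<Sigma>. \<forall>H \<in> ?\<Gamma>. \<Phi> (Paige A F) = H \<longleftrightarrow> F = fixed_field P H"
    proof (intro ballI)
      fix F H assume F: "F \<in> ?\<Sigma>" and "H \<in> ?\<Gamma>"
      then obtain F' where "F' \<in> ?\<Sigma>" "H = ?G F'" "F' = fixed_field P H" using field by blast
      then show "\<Phi> (Paige A F) = H \<longleftrightarrow> F = fixed_field P H" using \<Phi>[OF F] inj[OF F] by metis
    qed
    show "\<forall>F \<in> ?\<Sigma>. ?G F \<in> ?\<Gamma> \<and> \<Phi> (Paige A F) = ?G F \<and>
       (\<exists>\<theta> \<in> iso (field_Aut A F) (field_Aut A P Mod ?G F).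
          \<forall>\<phi> \<in> carrier (field_Aut A P).
            restrict \<phi> F \<in> carrier (field_Aut A F) \<and>
            \<theta> (restrict \<phi> F) = ?G F #>\<^bsub>field_Aut A P\<^esub> \<phi>)"
    proof (intro ballI conjI)
      fix F assume F: "F \<in> ?\<Sigma>"
      note r = restriction[OF F]
      show "?G F \<in> ?\<Gamma>" by (rule group[OF F])
      show "\<Phi> (Paige A F) = ?G F" by (rule \<Phi>[OF F])
      have "restrict \<phi> F \<in> carrier (field_Aut A F)" if "\<phi> \<in> carrier (field_Aut A P)" for \<phi>
        using r(3) that by blast
      then show "\<exists>\<theta> \<in> iso (field_Aut A F) (field_Aut A P Mod ?G F).
          \<forall>\<phi> \<in> carrier (field_Aut A P).
            restrict \<phi> F \<in> carrier (field_Aut A F) \<and>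
            \<theta> (restrict \<phi> F) = ?G F #>\<^bsub>field_Aut A P\<^esub> \<phi>"
        using group_hom.factor_iso_of_surj[OF r(1,3)] unfolding r(2) by blast
    qed
    show "\<forall>F \<in> ?\<Sigma>. F = fixed_field P (?G F) \<and> (\<forall>F' \<in> ?\<Sigma>. ?G F' = ?G F \<longrightarrow> F' = F)"
      using fixed inj by simp
    show "\<forall>H \<in> ?\<Gamma>. \<exists>F \<in> ?\<Sigma>. H = ?G F \<and> F = fixed_field P H"
      using field by blast
    show "\<forall>F \<in> ?\<Sigma>. \<forall>F' \<in> ?\<Sigma>.
       let H = ?G F; H' = ?G F' in
       (subloop_of (Paige A F) (Paige A F') \<longleftrightarrow> H \<supseteq> H') \<and>
       (proper_subloop_of (Paige A F) (Paige A F') \<longleftrightarrow> H \<supset> H') \<and>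
       (Paige A F \<noteq> Paige A F' \<longleftrightarrow> H \<noteq> H') \<and>
       (subloop_of (Paige A F') (Paige A F) \<longleftrightarrow> H \<subseteq> H') \<and>
       (proper_subloop_of (Paige A F') (Paige A F) \<longleftrightarrow> H \<subset> H')"
      unfolding Let_def proper_subloop_of_def psubset_eq
      by (intro ballI) (simp add: loop_sub loop_eq anti inj eq_commute)
  qed
qed

end
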